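(* Let $n\ge 1$. There is a constant $C_n>0$ depending only on $n$ such that the following holds. Let $(u_0,u_1)\in \left(D(L^{1/2})\cap L^1(\mathbf{R}^n)\right)\times\left(L^2(\mathbf{R}^n)\cap L^1(\mathbf{R}^n)\right)$ and let $u$ be the solution of $$u_{tt}+Lu+Lu_t=0\ \text{ in }(0,\infty)\times\mathbf{R}^n,\qquad u(0,x)=u_0(x),\quad u_t(0,x)=u_1(x).$$ Then, for all sufficiently large $t$, $$\|u_t(t,\cdot)\|_{L^2}^2+\|L^{1/2}u(t,\cdot)\|_{L^2}^2\le C_n\left(\|u_1\|_{L^1}^2\,t^{-\frac n2}+\|u_0\|_{L^1}^2\,t^{-\frac{n+2}{2}}\right)+2^{-\frac t4}\left(\|u_1\|_{L^2}^2+\|u_0\|_{L^2}^2\right)+2e^{-\frac t4}E_u(0).$$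
   Context: The Fourier transform is $\hat f(\xi)=\int_{\mathbf{R}^n}e^{-ix\cdot\xi}f(x)\,dx$, with inverse $\mathcal{F}^{-1}_{\xi\to x}$. The operator $L=\log(I-\Delta)$ on $L^2(\mathbf{R}^n)$ has domain $D(L)=\{f\in L^2(\mathbf{R}^n):\int_{\mathbf{R}^n}(\log(1+|\xi|^2))^2|\hat f(\xi)|^2d\xi<\infty\}$ and is given by $Lf=\mathcal{F}^{-1}_{\xi\to x}(\log(1+|\xi|^2)\hat f(\xi))$. It is nonnegative and self-adjoint. Its square root $L^{1/2}$ is the Fourier multiplier with symbol $\sqrt{\log(1+|\xi|^2)}$ and domain $D(L^{1/2})=\{f\in L^2(\mathbf{R}^n):\int_{\mathbf{R}^n}\log(1+|\xi|^2)|\hat f(\xi)|^2d\xi<\infty\}$, a Hilbert space with the graph norm. For $u_0\in D(L^{1/2})$, $u_1\in L^2(\mathbf{R}^n)$, "the solution" is the unique mild solution $u\in C([0,\infty);D(L^{1/2}))\cap C^1([0,\infty);L^2(\mathbf{R}^n))$; equivalently, for a.e. $\xi$, $\hat u(\cdot,\xi)$ solves the ODE $\hat u_{tt}+\log(1+|\xi|^2)\hat u+\log(1+|\xi|^2)\hat u_t=0$ with $\hat u(0,\xi)=\hat u_0(\xi)$, $\hat u_t(0,\xi)=\hat u_1(\xi)$. The energy is $E_u(t)=\frac12\left(\|u_t(t,\cdot)\|_{L^2}^2+\|L^{1/2}u(t,\cdot)\|_{L^2}^2\right)$. *)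

theory Defs
  imports "HOL-Analysis.Analysis"
begin

section \<open>Function spaces\<close>

text \<open>
  Elements of \<open>L\<^sup>1\<close> and \<open>L\<^sup>2\<close> are represented by Borel measurable, complex-valued functions; every
  notion below is invariant under changing a representative on a null set.
\<close>

definition L1_space :: "('a::euclidean_space \<Rightarrow> complex) set" where
  "L1_space = {f. integrable lborel f}"

definition L2_space :: "('a::euclidean_space \<Rightarrow> complex) set" where
  "L2_space = {f \<in> borel_measurable lborel. integrable lborel (\<lambda>x. (cmod (f x))\<^sup>2)}"

definition L1_norm :: "('a::euclidean_space \<Rightarrow> complex) \<Rightarrow> real" where
  "L1_norm f = (\<integral>x. cmod (f x) \<partial>lborel)"

definition L2_norm :: "('a::euclidean_space \<Rightarrow> complex) \<Rightarrow> real" where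
  "L2_norm f = sqrt (\<integral>x. (cmod (f x))\<^sup>2 \<partial>lborel)"


section \<open>Fourier transform\<close>

definition fourier_integral :: "('a::euclidean_space \<Rightarrow> complex) \<Rightarrow> 'a \<Rightarrow> complex" where
  "fourier_integral f \<xi> = (\<integral>x. exp (- (\<i> * complex_of_real (x \<bullet> \<xi>))) * f x \<partial>lborel)"

text \<open>
  The Fourier transform on \<open>L\<^sup>2\<close> is the limit in \<open>L\<^sup>2\<close> of the integrals over balls. The
  convergence is stated with the extended integral, because the Bochner integral of a
  non-integrable function is \<open>0\<close>.
\<close>

definition is_fourier :: "('a::euclidean_space \<Rightarrow> complex) \<Rightarrow> ('a \<Rightarrow> complex) \<Rightarrow> bool" where
  "is_fourier f g \<longleftrightarrow> f \<in> L2_space \<and> g \<in> L2_space \<and>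
     ((\<lambda>R::real. \<integral>\<^sup>+\<xi>. ennreal ((cmod (fourier_integral (\<lambda>x. indicator (cball 0 R) x * f x) \<xi> - g \<xi>))\<^sup>2)
         \<partial>lborel) \<longlongrightarrow> 0) at_top"

text \<open>On \<open>L\<^sup>2\<close> both maps are determined up to null sets; a representative is chosen.\<close>

definition fourier :: "('a::euclidean_space \<Rightarrow> complex) \<Rightarrow> 'a \<Rightarrow> complex" where
  "fourier f = (SOME g. is_fourier f g)"

definition inv_fourier :: "('a::euclidean_space \<Rightarrow> complex) \<Rightarrow> 'a \<Rightarrow> complex" where
  "inv_fourier g = (SOME f. is_fourier f g)"


section \<open>The square root of \<open>L = log (I - \<Delta>)\<close>\<close>

definition L_symbol :: "'a::euclidean_space \<Rightarrow> real" where
  "L_symbol \<xi> = ln (1 + (norm \<xi>)\<^sup>2)"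

definition sqrtL_domain :: "('a::euclidean_space \<Rightarrow> complex) set" where
  "sqrtL_domain =
     {f \<in> L2_space. integrable lborel (\<lambda>\<xi>. L_symbol \<xi> * (cmod (fourier f \<xi>))\<^sup>2)}"

definition sqrtL :: "('a::euclidean_space \<Rightarrow> complex) \<Rightarrow> 'a \<Rightarrow> complex" where
  "sqrtL f = inv_fourier (\<lambda>\<xi>. complex_of_real (sqrt (L_symbol \<xi>)) * fourier f \<xi>)"

definition graph_norm :: "('a::euclidean_space \<Rightarrow> complex) \<Rightarrow> real" where
  "graph_norm f = sqrt ((L2_norm f)\<^sup>2 + (L2_norm (sqrtL f))\<^sup>2)"


section \<open>Solutions\<close>

text \<open>
  A curve \<open>u\<close> with values in a function space is a function of time; only its values at
  times \<open>t \<ge> 0\<close> matter. Derivatives at time \<open>0\<close> are one-sided.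
\<close>

definition continuous_curve ::
    "(('a::euclidean_space \<Rightarrow> complex) \<Rightarrow> real) \<Rightarrow> (real \<Rightarrow> 'a \<Rightarrow> complex) \<Rightarrow> bool" where
  "continuous_curve N u \<longleftrightarrow>
     (\<forall>t\<ge>0. ((\<lambda>s. N (\<lambda>x. u s x - u t x)) \<longlongrightarrow> 0) (at t within {0..}))"

definition has_L2_derivative ::
    "(real \<Rightarrow> 'a::euclidean_space \<Rightarrow> complex) \<Rightarrow> ('a \<Rightarrow> complex) \<Rightarrow> real \<Rightarrow> bool" where
  "has_L2_derivative u v t \<longleftrightarrow> v \<in> L2_space \<and>
     ((\<lambda>s. L2_norm (\<lambda>x. (u s x - u t x) / complex_of_real (s - t) - v x)) \<longlongrightarrow> 0)
       (at t within {0..})"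

definition time_deriv :: "(real \<Rightarrow> 'a::euclidean_space \<Rightarrow> complex) \<Rightarrow> real \<Rightarrow> 'a \<Rightarrow> complex" where
  "time_deriv u t = (SOME v. has_L2_derivative u v t)"

definition C1_L2_curve :: "(real \<Rightarrow> 'a::euclidean_space \<Rightarrow> complex) \<Rightarrow> bool" where
  "C1_L2_curve u \<longleftrightarrow> (\<forall>t\<ge>0. u t \<in> L2_space \<and> has_L2_derivative u (time_deriv u t) t) \<and>
     continuous_curve L2_norm (time_deriv u)"

text \<open>\<open>y'' + a y + a y' = 0\<close> on \<open>[0, \<infinity>)\<close> with \<open>y(0) = y0\<close> and \<open>y'(0) = y1\<close>.\<close>

definition solves_ode :: "real \<Rightarrow> complex \<Rightarrow> complex \<Rightarrow> (real \<Rightarrow> complex) \<Rightarrow> bool" where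
  "solves_ode a y0 y1 y \<longleftrightarrow>
     (\<exists>y' y''. (\<forall>t\<ge>0. (y has_vector_derivative y' t) (at t within {0..}) \<and>
                       (y' has_vector_derivative y'' t) (at t within {0..}) \<and>
                       y'' t + complex_of_real a * y t + complex_of_real a * y' t = 0) \<and>
               y 0 = y0 \<and> y' 0 = y1)"

text \<open>
  The solution of \<open>u\<^sub>t\<^sub>t + L u + L u\<^sub>t = 0\<close>, \<open>u(0) = u0\<close>, \<open>u\<^sub>t(0) = u1\<close>, in the class
  \<open>C([0,\<infinity>); D(L\<^sup>1\<^sup>/\<^sup>2)) \<inter> C\<^sup>1([0,\<infinity>); L\<^sup>2)\<close>. The equation is read on the Fourier side, for almost every
  frequency. As the Fourier transform of \<open>u t\<close> is only defined up to a null set depending on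
  \<open>t\<close>, this means that suitable representatives \<open>U t\<close> satisfy the ordinary differential equation.
\<close>

definition is_solution ::
    "('a::euclidean_space \<Rightarrow> complex) \<Rightarrow> ('a \<Rightarrow> complex) \<Rightarrow> (real \<Rightarrow> 'a \<Rightarrow> complex) \<Rightarrow> bool" where
  "is_solution u0 u1 u \<longleftrightarrow>
     (\<forall>t\<ge>0. u t \<in> sqrtL_domain) \<and> continuous_curve graph_norm u \<and> C1_L2_curve u \<and>
     (\<exists>U. (\<forall>t\<ge>0. AE \<xi> in lborel. U t \<xi> = fourier (u t) \<xi>) \<and>
          (AE \<xi> in lborel. solves_ode (L_symbol \<xi>) (fourier u0 \<xi>) (fourier u1 \<xi>) (\<lambda>t. U t \<xi>)))"

definition energy :: "(real \<Rightarrow> 'a::euclidean_space \<Rightarrow> complex) \<Rightarrow> real \<Rightarrow> real" where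
  "energy u t = ((L2_norm (time_deriv u t))\<^sup>2 + (L2_norm (sqrtL (u t)))\<^sup>2) / 2"

end

theory Submission imports Defs "HOL-Probability.Characteristic_Functions" begin

text \<open>
  On the Fourier side the equation is, for every frequency, a damped oscillator with
  \<open>a = log (1 + |\<xi>|\<^sup>2)\<close>. A Lyapunov functional shows that its energy \<open>|y'|\<^sup>2 + a |y|\<^sup>2\<close> decays like
  \<open>exp (- a t / 2)\<close> for \<open>a \<le> 1\<close> and like \<open>exp (- 3 t / 10)\<close> for \<open>a \<ge> log 2\<close>. By Plancherel the
  high frequencies \<open>|\<xi>| > 1\<close> contribute at most a multiple of \<open>exp (- 3 t / 10)\<close> times the initial
  energy. On \<open>|\<xi>| \<le> 1\<close> the symbol lies between \<open>|\<xi>|\<^sup>2 / 2\<close> and \<open>|\<xi>|\<^sup>2\<close> and the transforms of the data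
  are bounded by their \<open>L\<^sup>1\<close> norms, so the integrals are Gaussian and give the powers of \<open>t\<close>.

  For Plancherel's theorem on \<open>L\<^sup>1 \<inter> L\<^sup>2\<close>, the integral of \<open>|F f|\<^sup>2\<close> against a wide Gaussian equals
  that of \<open>\<parallel>f\<parallel>\<^sup>2 - \<parallel>f(\<cdot> - z) - f\<parallel>\<^sup>2 / 2\<close> against a narrow one, and translation is continuous
  in \<open>L\<^sup>2\<close>. The \<open>L\<^sup>2\<close> transform is then built by completeness, and it is onto because its adjoint
  is an isometry up to a constant too.
\<close>

section \<open>The Hilbert space \<open>L\<^sup>2\<close>\<close>

text \<open>The equation is given only for almost every frequency, and for representatives
  \<open>U t\<close> that agree with the transform of \<open>u t\<close> off a null set depending on
  \<open>t\<close>. The oscillator estimate speaks of the derivative of \<open>U\<close> at a fixed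
  frequency, the energy of the derivative of \<open>u\<close> in the L2 norm; the two have to be
  identified almost everywhere (\<open>fourier_has_L2_derivative\<close>). The same identification
  at time 0 recovers the data, since \<open>is_solution\<close> ties \<open>u0\<close> and
  \<open>u1\<close> to \<open>u\<close> only through the initial values of the ordinary differential
  equation.

  Surjectivity of the L2 transform is forced by the definitions: \<open>sqrtL\<close> selects an
  inverse transform, and its norm can be evaluated once a preimage is known to exist.

  The two powers of \<open>t\<close> differ by \<open>1 / t\<close> because the initial oscillator
  energy weights \<open>u0\<close> by \<open>a\<close>, and \<open>a * exp (- a t / 2)\<close> is at
  most a multiple of \<open>1 / t\<close>. At high frequencies the L1 norms give no help: they bound
  the transforms but yield no integrability at infinity.\<close>

lemma L2_space_measurable [measurable_dest]: "f \<in> L2_space \<Longrightarrow> f \<in> borel_measurable borel"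
  by (simp add: L2_space_def)

lemma L2_spaceD: "f \<in> L2_space \<Longrightarrow> integrable lborel (\<lambda>x. (cmod (f x))\<^sup>2)"
  by (simp add: L2_space_def)

lemma L2_spaceI:
  assumes "f \<in> borel_measurable borel" "integrable lborel g" "\<And>x. (cmod (f x))\<^sup>2 \<le> g x"
  shows "f \<in> L2_space"
proof -
  have "(cmod (f x))\<^sup>2 \<le> \<bar>g x\<bar>" for x
    using assms(3)[of x] by linarith
  then show ?thesis
    using assms(1) unfolding L2_space_def by (auto intro!: Bochner_Integration.integrable_bound[OF assms(2)])
qed

lemma cmod_add_sq_le: "(cmod (a + b))\<^sup>2 \<le> 2 * (cmod a)\<^sup>2 + 2 * (cmod b)\<^sup>2"
proof -
  have "(cmod (a + b))\<^sup>2 \<le> (cmod a + cmod b)\<^sup>2"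
    by (intro power_mono norm_triangle_ineq) auto
  also have "\<dots> \<le> 2 * (cmod a)\<^sup>2 + 2 * (cmod b)\<^sup>2"
    using sum_squares_bound[of "cmod a" "cmod b"] by (simp add: power2_sum)
  finally show ?thesis .
qed

lemma L2_space_add: "f \<in> L2_space \<Longrightarrow> g \<in> L2_space \<Longrightarrow> (\<lambda>x. f x + g x) \<in> L2_space"
  by (rule L2_spaceI[where g = "\<lambda>x. 2 * (cmod (f x))\<^sup>2 + 2 * (cmod (g x))\<^sup>2"])
     (auto intro!: L2_spaceD cmod_add_sq_le)

lemma L2_space_cmult: "f \<in> L2_space \<Longrightarrow> (\<lambda>x. c * f x) \<in> L2_space"
  by (rule L2_spaceI[where g = "\<lambda>x. (cmod c)\<^sup>2 * (cmod (f x))\<^sup>2"])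
     (auto intro!: L2_spaceD simp: norm_mult power_mult_distrib)

lemma L2_space_diff: "f \<in> L2_space \<Longrightarrow> g \<in> L2_space \<Longrightarrow> (\<lambda>x. f x - g x) \<in> L2_space"
  using L2_space_add[OF _ L2_space_cmult, of f g "-1"] by simp

lemma borel_measurable_cnj [measurable]: "cnj \<in> borel_measurable borel"
  by (intro borel_measurable_continuous_onI continuous_intros)

lemma L2_space_cnj: "f \<in> L2_space \<Longrightarrow> (\<lambda>x. cnj (f x)) \<in> L2_space"
  by (rule L2_spaceI[where g = "\<lambda>x. (cmod (f x))\<^sup>2"]) (auto intro!: L2_spaceD)

lemma L2_space_indicator:
  "f \<in> L2_space \<Longrightarrow> A \<in> sets borel \<Longrightarrow> (\<lambda>x. indicator A x * f x) \<in> L2_space"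
  by (rule L2_spaceI[where g = "\<lambda>x. (cmod (f x))\<^sup>2"])
     (auto intro!: L2_spaceD simp: norm_mult power_mult_distrib split: split_indicator)

lemma L2_space_mult_integrable:
  assumes "f \<in> L2_space" "g \<in> L2_space"
  shows "integrable lborel (\<lambda>x. f x * g x)"
proof (rule Bochner_Integration.integrable_bound)
  show "integrable lborel (\<lambda>x. (cmod (f x))\<^sup>2 + (cmod (g x))\<^sup>2)"
    using assms by (auto intro!: L2_spaceD)
  have "a * b \<le> a\<^sup>2 + b\<^sup>2" for a b :: real
    using sum_squares_bound[of a b] zero_le_power2[of a] zero_le_power2[of b] by linarith
  then show "AE x in lborel. norm (f x * g x) \<le> norm ((cmod (f x))\<^sup>2 + (cmod (g x))\<^sup>2)"
    by (auto simp: norm_mult)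
qed (use assms in measurable)

lemma L2_norm_nonneg [simp]: "0 \<le> L2_norm f"
  by (simp add: L2_norm_def)

lemma L2_norm_power2: "(L2_norm f)\<^sup>2 = (\<integral>x. (cmod (f x))\<^sup>2 \<partial>lborel)"
  by (simp add: L2_norm_def)

lemma nn_integral_L2_space:
  "f \<in> L2_space \<Longrightarrow> (\<integral>\<^sup>+x. ennreal ((cmod (f x))\<^sup>2) \<partial>lborel) = ennreal ((L2_norm f)\<^sup>2)"
  by (simp add: L2_norm_power2 L2_spaceD nn_integral_eq_integral)

lemma L2_space_iff_nn_integral:
  "f \<in> borel_measurable borel \<Longrightarrow>
    f \<in> L2_space \<longleftrightarrow> (\<integral>\<^sup>+x. ennreal ((cmod (f x))\<^sup>2) \<partial>lborel) < \<infinity>"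
  by (simp add: L2_space_def integrable_iff_bounded)

lemma L2_norm_cong_AE:
  assumes "f \<in> borel_measurable borel" "g \<in> borel_measurable borel" "AE x in lborel. f x = g x"
  shows "L2_norm f = L2_norm g"
  unfolding L2_norm_def using assms
  by (intro arg_cong[where f = sqrt] integral_cong_AE) auto

lemma L2_norm_eq_0_iff_AE:
  assumes "f \<in> L2_space"
  shows "L2_norm f = 0 \<longleftrightarrow> (AE x in lborel. f x = 0)"
  using integral_nonneg_eq_0_iff_AE[OF L2_spaceD[OF assms]] by (simp add: L2_norm_def)

lemma L2_norm_add_power2:
  assumes "f \<in> L2_space" "g \<in> L2_space"
  shows "(L2_norm (\<lambda>x. f x + g x))\<^sup>2 =
    (L2_norm f)\<^sup>2 + 2 * Re (\<integral>x. f x * cnj (g x) \<partial>lborel) + (L2_norm g)\<^sup>2"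
proof -
  have *: "(cmod (a + b))\<^sup>2 = (cmod a)\<^sup>2 + 2 * Re (a * cnj b) + (cmod b)\<^sup>2" for a b
    by (simp only: cmod_power2) (simp add: power2_eq_square algebra_simps)
  have i: "integrable lborel (\<lambda>x. f x * cnj (g x))"
    using assms by (intro L2_space_mult_integrable L2_space_cnj)
  have "(\<integral>x. (cmod (f x + g x))\<^sup>2 \<partial>lborel) =
      (\<integral>x. (cmod (f x))\<^sup>2 \<partial>lborel) + 2 * (\<integral>x. Re (f x * cnj (g x)) \<partial>lborel) + (\<integral>x. (cmod (g x))\<^sup>2 \<partial>lborel)"
    unfolding * using assms i
    by (simp add: L2_spaceD integrable_Re del: times_complex.sel)
  then show ?thesis
    using i by (simp add: L2_norm_power2 del: times_complex.sel)
qed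

lemma L2_norm_cmult: "L2_norm (\<lambda>x. c * f x) = cmod c * L2_norm f"
  by (simp add: L2_norm_def norm_mult power_mult_distrib real_sqrt_mult)

lemma L2_norm_cnj: "L2_norm (\<lambda>x. cnj (f x)) = L2_norm f"
  by (simp add: L2_norm_def)

lemma L2_norm_minus_commute: "L2_norm (\<lambda>x. f x - g x) = L2_norm (\<lambda>x. g x - f x)"
  by (simp add: L2_norm_def norm_minus_commute)

lemma L2_norm_diff_power2:
  assumes "f \<in> L2_space" "g \<in> L2_space"
  shows "(L2_norm (\<lambda>x. f x - g x))\<^sup>2 =
    (L2_norm f)\<^sup>2 - 2 * Re (\<integral>x. f x * cnj (g x) \<partial>lborel) + (L2_norm g)\<^sup>2"
  using L2_norm_add_power2[OF assms(1) L2_space_cmult[OF assms(2)], of "-1"]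
  by (simp add: L2_norm_cmult[of "-1", simplified])

text \<open>Stated for the bilinear pairing, without conjugation, because this is the pairing for
  which the Fourier transform is symmetric.\<close>

lemma L2_Cauchy_Schwarz:
  assumes "f \<in> L2_space" "g \<in> L2_space"
  shows "cmod (\<integral>x. f x * g x \<partial>lborel) \<le> L2_norm f * L2_norm g"
proof -
  have i: "integrable lborel (\<lambda>x. f x * g x)"
    by (rule L2_space_mult_integrable) fact+
  have "(\<integral>\<^sup>+x. ennreal (cmod (f x * g x)) \<partial>lborel)\<^sup>2
      \<le> (\<integral>\<^sup>+x. ennreal ((cmod (f x))\<^sup>2) \<partial>lborel) * (\<integral>\<^sup>+x. ennreal ((cmod (g x))\<^sup>2) \<partial>lborel)"
    using Cauchy_Schwarz_nn_integral[of "\<lambda>x. ennreal (cmod (f x))" lborel "\<lambda>x. ennreal (cmod (g x))"] assms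
    by (simp add: norm_mult ennreal_mult' ennreal_power)
  also have "(\<integral>\<^sup>+x. ennreal (cmod (f x * g x)) \<partial>lborel) = ennreal (\<integral>x. cmod (f x * g x) \<partial>lborel)"
    using i by (intro nn_integral_eq_integral) auto
  finally have "(\<integral>x. cmod (f x * g x) \<partial>lborel)\<^sup>2 \<le> (L2_norm f)\<^sup>2 * (L2_norm g)\<^sup>2"
    using assms by (simp add: nn_integral_L2_space ennreal_power flip: ennreal_mult')
  then have "(\<integral>x. cmod (f x * g x) \<partial>lborel) \<le> L2_norm f * L2_norm g"
    by (intro power2_le_imp_le[of _ "L2_norm f * L2_norm g", OF _ mult_nonneg_nonneg])
       (simp_all add: power_mult_distrib)
  then show ?thesis
    by (rule order_trans[OF integral_norm_bound])
qed

lemma L2_norm_triangle: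
  assumes "f \<in> L2_space" "g \<in> L2_space"
  shows "L2_norm (\<lambda>x. f x + g x) \<le> L2_norm f + L2_norm g"
proof (rule power2_le_imp_le)
  have "Re (\<integral>x. f x * cnj (g x) \<partial>lborel) \<le> L2_norm f * L2_norm g"
    using L2_Cauchy_Schwarz[OF assms(1) L2_space_cnj[OF assms(2)]]
      complex_Re_le_cmod[of "\<integral>x. f x * cnj (g x) \<partial>lborel"] by (simp add: L2_norm_cnj)
  then show "(L2_norm (\<lambda>x. f x + g x))\<^sup>2 \<le> (L2_norm f + L2_norm g)\<^sup>2"
    by (simp add: L2_norm_add_power2[OF assms] power2_sum)
qed simp

lemma L2_norm_diff_triangle:
  assumes "f \<in> L2_space" "g \<in> L2_space" "h \<in> L2_space"
  shows "L2_norm (\<lambda>x. f x - h x) \<le> L2_norm (\<lambda>x. f x - g x) + L2_norm (\<lambda>x. g x - h x)"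
  using L2_norm_triangle[OF L2_space_diff[OF assms(1,2)] L2_space_diff[OF assms(2,3)]] by simp

lemma L2_norm_triangle_sub:
  assumes "f \<in> L2_space" "g \<in> L2_space"
  shows "\<bar>L2_norm f - L2_norm g\<bar> \<le> L2_norm (\<lambda>x. f x - g x)"
  using L2_norm_triangle[OF L2_space_diff[OF assms] assms(2)]
    L2_norm_triangle[OF L2_space_diff[OF assms(2,1)] assms(1)] L2_norm_minus_commute[of f g]
  by simp

section \<open>Continuity of the norm and of the pairing\<close>

lemma tendsto_L2_norm:
  assumes "\<And>i. F i \<in> L2_space" "f \<in> L2_space" "((\<lambda>i. L2_norm (\<lambda>x. F i x - f x)) \<longlongrightarrow> 0) A"
  shows "((\<lambda>i. L2_norm (F i)) \<longlongrightarrow> L2_norm f) A"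
proof -
  have "((\<lambda>i. L2_norm (F i) - L2_norm f) \<longlongrightarrow> 0) A"
    using assms(3)
    by (rule Lim_null_comparison[rotated])
       (use L2_norm_triangle_sub[OF assms(1,2)] in \<open>simp add: always_eventually\<close>)
  then show ?thesis by (simp add: LIM_zero_iff)
qed

lemma tendsto_L2_inner:
  assumes "\<And>i. F i \<in> L2_space" "f \<in> L2_space" "((\<lambda>i. L2_norm (\<lambda>x. F i x - f x)) \<longlongrightarrow> 0) A"
    and "\<And>i. G i \<in> L2_space" "g \<in> L2_space" "((\<lambda>i. L2_norm (\<lambda>x. G i x - g x)) \<longlongrightarrow> 0) A"
  shows "((\<lambda>i. \<integral>x. F i x * G i x \<partial>lborel) \<longlongrightarrow> (\<integral>x. f x * g x \<partial>lborel)) A"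
proof -
  have "((\<lambda>i. L2_norm (\<lambda>x. F i x - f x) * L2_norm (G i) + L2_norm f * L2_norm (\<lambda>x. G i x - g x))
      \<longlongrightarrow> 0 * L2_norm g + L2_norm f * 0) A"
    by (intro tendsto_intros assms tendsto_L2_norm)
  then have lim: "((\<lambda>i. L2_norm (\<lambda>x. F i x - f x) * L2_norm (G i) + L2_norm f * L2_norm (\<lambda>x. G i x - g x))
      \<longlongrightarrow> 0) A" by simp
  have "norm ((\<integral>x. F i x * G i x \<partial>lborel) - (\<integral>x. f x * g x \<partial>lborel))
      \<le> L2_norm (\<lambda>x. F i x - f x) * L2_norm (G i) + L2_norm f * L2_norm (\<lambda>x. G i x - g x)" for i
  proof -
    have "(\<integral>x. F i x * G i x \<partial>lborel) - (\<integral>x. f x * g x \<partial>lborel)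
        = (\<integral>x. (F i x - f x) * G i x + f x * (G i x - g x) \<partial>lborel)"
      using assms
      by (subst Bochner_Integration.integral_diff[symmetric])
         (auto intro!: L2_space_mult_integrable Bochner_Integration.integral_cong simp: algebra_simps)
    also have "\<dots> = (\<integral>x. (F i x - f x) * G i x \<partial>lborel) + (\<integral>x. f x * (G i x - g x) \<partial>lborel)"
      using assms by (intro Bochner_Integration.integral_add L2_space_mult_integrable L2_space_diff)
    finally show ?thesis
      using norm_triangle_ineq[of "\<integral>x. (F i x - f x) * G i x \<partial>lborel" "\<integral>x. f x * (G i x - g x) \<partial>lborel"]
        L2_Cauchy_Schwarz[OF L2_space_diff[OF assms(1,2)] assms(4), of i i]
        L2_Cauchy_Schwarz[OF assms(2) L2_space_diff[OF assms(4,5)], of i]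
      by simp
  qed
  from Lim_null_comparison[OF always_eventually[OF allI] lim, OF this]
  have "((\<lambda>i. (\<integral>x. F i x * G i x \<partial>lborel) - (\<integral>x. f x * g x \<partial>lborel)) \<longlongrightarrow> 0) A" .
  then show ?thesis by (simp add: LIM_zero_iff)
qed

section \<open>Completeness\<close>

lemma L2_cauchy_subsequence_converges_AE:
  fixes F :: "nat \<Rightarrow> 'a::euclidean_space \<Rightarrow> complex"
  assumes F: "\<And>n. F n \<in> L2_space"
    and d: "\<And>n. (L2_norm (\<lambda>x. F (Suc n) x - F n x))\<^sup>2 \<le> (1/8) ^ n"
  shows "AE x in lborel. convergent (\<lambda>n. F n x)"
proof -
  \<comment> \<open>the weight makes the bound on the increments summable without Minkowski's inequality\<close>
  define D where "D n x = 2 ^ n * (cmod (F (Suc n) x - F n x))\<^sup>2" for n x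
  have [measurable]: "F n \<in> borel_measurable borel" for n
    using F by (rule L2_space_measurable)
  have [measurable]: "D n \<in> borel_measurable borel" for n
    unfolding D_def by measurable
  have "(\<integral>\<^sup>+x. (\<Sum>n. ennreal (D n x)) \<partial>lborel) = (\<Sum>n. \<integral>\<^sup>+x. ennreal (D n x) \<partial>lborel)"
    by (rule nn_integral_suminf) simp
  also have "\<dots> \<le> (\<Sum>n. ennreal ((1/4) ^ n))"
  proof (intro suminf_le)
    fix n
    have "(\<integral>\<^sup>+x. ennreal (D n x) \<partial>lborel) = ennreal (2 ^ n) * ennreal ((L2_norm (\<lambda>x. F (Suc n) x - F n x))\<^sup>2)"
      unfolding D_def using F
      by (simp add: ennreal_mult' nn_integral_cmult nn_integral_L2_space L2_space_diff)
    also have "\<dots> \<le> ennreal (2 ^ n) * ennreal ((1/8) ^ n)"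
      by (intro mult_left_mono ennreal_leI d) auto
    also have "\<dots> = ennreal ((1/4) ^ n)"
      by (simp flip: ennreal_mult' power_mult_distrib)
    finally show "(\<integral>\<^sup>+x. ennreal (D n x) \<partial>lborel) \<le> ennreal ((1/4) ^ n)" .
  qed auto
  also have "\<dots> < \<infinity>"
    by (subst suminf_ennreal2) (auto intro: summable_geometric)
  finally have "AE x in lborel. (\<Sum>n. ennreal (D n x)) \<noteq> \<infinity>"
    by (intro nn_integral_PInf_AE) auto
  then show ?thesis
  proof eventually_elim
    case (elim x)
    have nn: "0 \<le> D n x" for n by (simp add: D_def)
    have s: "summable (\<lambda>n. D n x)"
      using elim nn by (intro summable_suminf_not_top) auto
    have "summable (\<lambda>n. F (Suc n) x - F n x)"
    proof (rule summable_comparison_test')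
      show "summable (\<lambda>n. D n x + (1/2) ^ n)"
        by (intro summable_add s summable_geometric) auto
      fix n :: nat
      \<comment> \<open>The arithmetic-geometric mean inequality, with the weights
        \<open>2 ^ n\<close> and \<open>(1/2) ^ n\<close> chosen to cancel in the product. It bounds
        the increment itself, not its square, by the terms of two summable series.\<close>
      have "2 * (sqrt (2 ^ n) * cmod (F (Suc n) x - F n x)) * sqrt ((1/2) ^ n) \<le> D n x + (1/2) ^ n"
        using sum_squares_bound[of "sqrt (2 ^ n) * cmod (F (Suc n) x - F n x)" "sqrt ((1/2) ^ n)"]
        by (simp add: D_def power_mult_distrib)
      also have "2 * (sqrt (2 ^ n) * cmod (F (Suc n) x - F n x)) * sqrt ((1/2) ^ n)
          = 2 * cmod (F (Suc n) x - F n x) * sqrt (2 ^ n * (1/2) ^ n)"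
        by (simp add: real_sqrt_mult)
      also have "2 ^ n * (1/2::real) ^ n = 1"
        by (simp flip: power_mult_distrib)
      finally show "norm (F (Suc n) x - F n x) \<le> D n x + (1/2) ^ n"
        using norm_ge_zero[of "F (Suc n) x - F n x"] unfolding real_sqrt_one by linarith
    qed
    then have "convergent (\<lambda>n. \<Sum>i<n. F (Suc i) x - F i x)"
      by (simp add: summable_iff_convergent)
    then have "convergent (\<lambda>n. F n x - F 0 x)"
      using sum_lessThan_telescope[of "\<lambda>i. F i x"] by (simp only:)
    from convergent_add[OF this convergent_const[of "F 0 x"]] show ?case by simp
  qed
qed

text \<open>The Riesz-Fischer argument: a rapidly convergent subsequence has a pointwise limit
  almost everywhere, and Fatou's lemma turns the Cauchy condition into a bound on the distance to
  that limit.\<close>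

lemma L2_complete:
  fixes F :: "nat \<Rightarrow> 'a::euclidean_space \<Rightarrow> complex"
  assumes F: "\<And>n. F n \<in> L2_space"
    and Cauchy: "\<And>e. e > 0 \<Longrightarrow> \<exists>N. \<forall>m\<ge>N. \<forall>n\<ge>N. L2_norm (\<lambda>x. F m x - F n x) < e"
  shows "\<exists>g\<in>L2_space. (\<lambda>n. L2_norm (\<lambda>x. F n x - g x)) \<longlonglongrightarrow> 0"
proof -
  have [measurable]: "F n \<in> borel_measurable borel" for n
    using F by (rule L2_space_measurable)
  \<comment> \<open>The indices are picked by dependent choice so that they increase strictly; the
    tolerance is the one that makes squared increments at most \<open>(1/8) ^ k\<close>.\<close>
  have "\<exists>N. \<forall>k. (\<forall>m\<ge>N k. \<forall>n\<ge>N k. L2_norm (\<lambda>x. F m x - F n x) < sqrt ((1/8) ^ k)) \<and> N k < N (Suc k)"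
  proof (rule dependent_nat_choice, goal_cases)
    case 1 then show ?case using Cauchy by simp
  next
    case (2 N k)
    obtain M where "\<forall>m\<ge>M. \<forall>n\<ge>M. L2_norm (\<lambda>x. F m x - F n x) < sqrt ((1/8) ^ Suc k)"
      using Cauchy[of "sqrt ((1/8) ^ Suc k)"] by auto
    then show ?case by (intro exI[of _ "max M (Suc N)"]) auto
  qed
  then obtain N where N: "\<And>k m n. m \<ge> N k \<Longrightarrow> n \<ge> N k \<Longrightarrow> L2_norm (\<lambda>x. F m x - F n x) < sqrt ((1/8) ^ k)"
    and Nmono: "strict_mono N"
    by (auto simp: strict_mono_Suc_iff)
  \<comment> \<open>\<open>lim\<close> takes an unspecified value where the subsequence diverges;
    those points form a null set, and \<open>g\<close> is Borel measurable all the same.\<close>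
  define g where "g x = lim (\<lambda>k. F (N k) x)" for x
  have [measurable]: "g \<in> borel_measurable borel"
    unfolding g_def by measurable
  have "AE x in lborel. convergent (\<lambda>k. F (N k) x)"
  proof (rule L2_cauchy_subsequence_converges_AE)
    fix k
    have "L2_norm (\<lambda>x. F (N (Suc k)) x - F (N k) x) \<le> sqrt ((1/8) ^ k)"
      using N[of k "N (Suc k)" "N k"] strict_mono_mono[OF Nmono] by (auto simp: mono_def less_imp_le)
    then have "(L2_norm (\<lambda>x. F (N (Suc k)) x - F (N k) x))\<^sup>2 \<le> (sqrt ((1/8) ^ k))\<^sup>2"
      by (intro power_mono) auto
    then show "(L2_norm (\<lambda>x. F (N (Suc k)) x - F (N k) x))\<^sup>2 \<le> (1/8) ^ k" by simp
  qed (use F in auto)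
  then have lim: "AE x in lborel. (\<lambda>k. F (N k) x) \<longlonglongrightarrow> g x"
    by eventually_elim (auto simp: g_def convergent_LIMSEQ_iff)
  \<comment> \<open>Fatou along the subsequence, with \<open>n\<close> fixed and arbitrary beyond
    \<open>N k\<close>. The bound therefore controls the whole sequence at once.\<close>
  have bound: "(\<integral>\<^sup>+x. ennreal ((cmod (F n x - g x))\<^sup>2) \<partial>lborel) \<le> ennreal ((1/8) ^ k)" if n: "n \<ge> N k" for n k
  proof -
    have "(\<integral>\<^sup>+x. ennreal ((cmod (F n x - g x))\<^sup>2) \<partial>lborel)
        = (\<integral>\<^sup>+x. liminf (\<lambda>j. ennreal ((cmod (F n x - F (N j) x))\<^sup>2)) \<partial>lborel)"
    proof (rule nn_integral_cong_AE, use lim in eventually_elim)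
      case (elim x)
      have "(\<lambda>j. ennreal ((cmod (F n x - F (N j) x))\<^sup>2)) \<longlonglongrightarrow> ennreal ((cmod (F n x - g x))\<^sup>2)"
        by (intro tendsto_ennrealI tendsto_intros elim)
      then show ?case by (rule lim_imp_Liminf[symmetric, rotated]) simp
    qed
    also have "\<dots> \<le> liminf (\<lambda>j. \<integral>\<^sup>+x. ennreal ((cmod (F n x - F (N j) x))\<^sup>2) \<partial>lborel)"
      by (intro nn_integral_liminf) measurable
    also have "\<dots> \<le> liminf (\<lambda>j. ennreal ((1/8) ^ k))"
    proof (rule Liminf_mono, rule eventually_sequentiallyI)
      fix j assume "k \<le> j"
      then have "N k \<le> N j" using strict_mono_mono[OF Nmono] by (auto simp: mono_def)
      then have "(L2_norm (\<lambda>x. F n x - F (N j) x))\<^sup>2 \<le> (sqrt ((1/8) ^ k))\<^sup>2"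
        using N[OF n, of "N j"] by (intro power_mono) auto
      then show "(\<integral>\<^sup>+x. ennreal ((cmod (F n x - F (N j) x))\<^sup>2) \<partial>lborel) \<le> ennreal ((1/8) ^ k)"
        using F by (simp add: nn_integral_L2_space L2_space_diff)
    qed
    finally show ?thesis by (simp add: Liminf_const)
  qed
  \<comment> \<open>The case \<open>k = 0\<close> shows that the difference to \<open>g\<close> has
    finite norm, whence \<open>g\<close> itself lies in the space.\<close>
  have d: "(\<lambda>x. F (N 0) x - g x) \<in> L2_space"
    using le_less_trans[OF bound[of 0 "N 0"]] by (subst L2_space_iff_nn_integral) auto
  have g: "g \<in> L2_space"
    using L2_space_diff[OF F d, of "N 0"] by simp
  have "(\<lambda>n. L2_norm (\<lambda>x. F n x - g x)) \<longlonglongrightarrow> 0"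
  proof (rule LIMSEQ_I)
    fix e :: real assume "e > 0"
    then obtain k where k: "(1/8::real) ^ k < e\<^sup>2"
      using real_arch_pow_inv[of "e\<^sup>2" "1/8"] by auto
    show "\<exists>no. \<forall>n\<ge>no. norm (L2_norm (\<lambda>x. F n x - g x) - 0) < e"
    proof (intro exI allI impI)
      fix n assume "N k \<le> n"
      then have "(L2_norm (\<lambda>x. F n x - g x))\<^sup>2 \<le> (1/8) ^ k"
        using bound[of k n] F g by (simp add: nn_integral_L2_space L2_space_diff)
      then have "(L2_norm (\<lambda>x. F n x - g x))\<^sup>2 < e\<^sup>2" using k by simp
      then show "norm (L2_norm (\<lambda>x. F n x - g x) - 0) < e"
        using \<open>e > 0\<close> power_less_imp_less_base[of "L2_norm (\<lambda>x. F n x - g x)" 2 e] by simp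
    qed
  qed
  with g show ?thesis by blast
qed

text \<open>This lets a limit in the L2 norm be compared with a limit taken at each point
  separately, as is done for difference quotients in time.\<close>

lemma L2_tendsto_AE_subseq:
  fixes F :: "nat \<Rightarrow> 'a::euclidean_space \<Rightarrow> complex"
  assumes "\<And>n. F n \<in> L2_space" "g \<in> L2_space" "(\<lambda>n. L2_norm (\<lambda>x. F n x - g x)) \<longlonglongrightarrow> 0"
  shows "\<exists>r :: nat \<Rightarrow> nat. strict_mono r \<and> (AE x in lborel. (\<lambda>n. F (r n) x) \<longlonglongrightarrow> g x)"
proof -
  have "\<exists>r. strict_mono r \<and> (AE x in lborel. (\<lambda>n. (cmod (F (r n) x - g x))\<^sup>2) \<longlonglongrightarrow> 0)"
  proof (rule tendsto_L1_AE_subseq)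
    show "integrable lborel (\<lambda>x. (cmod (F n x - g x))\<^sup>2)" for n
      using assms by (intro L2_spaceD L2_space_diff)
    show "(\<lambda>n. \<integral>x. norm ((cmod (F n x - g x))\<^sup>2) \<partial>lborel) \<longlonglongrightarrow> 0"
      using tendsto_power[OF assms(3), of 2] by (simp add: L2_norm_power2)
  qed
  then obtain r where "strict_mono r" "AE x in lborel. (\<lambda>n. (cmod (F (r n) x - g x))\<^sup>2) \<longlonglongrightarrow> 0"
    by blast
  moreover from this(2) have "AE x in lborel. (\<lambda>n. F (r n) x) \<longlonglongrightarrow> g x"
  proof eventually_elim
    case (elim x)
    from tendsto_real_sqrt[OF this] have "(\<lambda>n. cmod (F (r n) x - g x)) \<longlonglongrightarrow> 0" by simp
    then show ?case by (simp add: tendsto_norm_zero_iff LIM_zero_iff)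
  qed
  ultimately show ?thesis by blast
qed

section \<open>Continuity of translation\<close>

lemma lborel_distr_diff_right: "distr lborel borel (\<lambda>x. x - z) = (lborel :: 'a::euclidean_space measure)"
  using lborel_distr_plus[of "-z"] by (simp add: add.commute[of "-z"] cong: distr_cong)

lemma lborel_distr_diff_left: "distr lborel borel (\<lambda>x. z - x) = (lborel :: 'a::euclidean_space measure)"
  using lborel_affine[of "-1" z] by (simp add: density_1)

lemma integrable_lborel_diff_right:
  fixes f :: "'a::euclidean_space \<Rightarrow> 'b::{banach, second_countable_topology}"
  assumes "integrable lborel f"
  shows "integrable lborel (\<lambda>x. f (x - z))"
proof -
  have "integrable (distr lborel borel (\<lambda>x. x - z)) f" using assms by (simp add: lborel_distr_diff_right)
  then show ?thesis by (subst (asm) integrable_distr_eq) (use assms in auto)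
qed

lemma integral_lborel_diff_right:
  fixes f :: "'a::euclidean_space \<Rightarrow> 'b::{banach, second_countable_topology}"
  assumes "f \<in> borel_measurable borel"
  shows "(\<integral>x. f (x - z) \<partial>lborel) = (\<integral>x. f x \<partial>lborel)"
proof -
  have "(\<integral>x. f (x - z) \<partial>lborel) = (\<integral>x. f x \<partial>distr lborel borel (\<lambda>x. x - z))"
    by (subst integral_distr) (use assms in auto)
  then show ?thesis by (simp add: lborel_distr_diff_right)
qed

lemma integral_lborel_diff_left:
  fixes f :: "'a::euclidean_space \<Rightarrow> 'b::{banach, second_countable_topology}"
  assumes "f \<in> borel_measurable borel"
  shows "(\<integral>x. f (z - x) \<partial>lborel) = (\<integral>x. f x \<partial>lborel)"
proof -
  have "(\<integral>x. f (z - x) \<partial>lborel) = (\<integral>x. f x \<partial>distr lborel borel (\<lambda>x. z - x))"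
    by (subst integral_distr) (use assms in auto)
  then show ?thesis by (simp add: lborel_distr_diff_left)
qed

text \<open>Translation preserves the integral, so replacing \<open>f\<close> by \<open>g\<close>
  costs the same error before and after the shift, and the triangle inequality gives three terms
  below \<open>e / 4\<close>. It serves two reductions: from Borel sets to open sets, and from
  integrable functions to simple ones.\<close>

lemma L1_translation_continuous_approx:
  fixes f :: "'a::euclidean_space \<Rightarrow> real"
  assumes f: "integrable lborel f"
    and approx: "\<And>e. e > 0 \<Longrightarrow> \<exists>g. integrable lborel g \<and> (\<integral>x. \<bar>f x - g x\<bar> \<partial>lborel) < e \<and>
      (\<lambda>n. \<integral>x. \<bar>g (x - X n) - g x\<bar> \<partial>lborel) \<longlonglongrightarrow> 0"
  shows "(\<lambda>n. \<integral>x. \<bar>f (x - X n) - f x\<bar> \<partial>lborel) \<longlonglongrightarrow> 0"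
proof (rule LIMSEQ_I)
  fix e :: real assume "e > 0"
  then obtain g where g: "integrable lborel g" "(\<integral>x. \<bar>f x - g x\<bar> \<partial>lborel) < e / 4"
      "(\<lambda>n. \<integral>x. \<bar>g (x - X n) - g x\<bar> \<partial>lborel) \<longlonglongrightarrow> 0"
    using approx[of "e / 4"] by auto
  obtain N where N: "\<And>n. n \<ge> N \<Longrightarrow> (\<integral>x. \<bar>g (x - X n) - g x\<bar> \<partial>lborel) < e / 4"
    using LIMSEQ_D[OF g(3), of "e / 4"] \<open>e > 0\<close> by auto
  note [measurable] = borel_measurable_integrable[OF f] borel_measurable_integrable[OF g(1)]
  have "(\<integral>x. \<bar>f (x - X n) - f x\<bar> \<partial>lborel) < e" if "n \<ge> N" for n
  proof -
    have i: "integrable lborel (\<lambda>x. \<bar>f (x - X n) - g (x - X n)\<bar>)"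
      "integrable lborel (\<lambda>x. \<bar>g (x - X n) - g x\<bar>)" "integrable lborel (\<lambda>x. \<bar>f x - g x\<bar>)"
      using f g(1)
      by (auto intro!: integrable_abs Bochner_Integration.integrable_diff integrable_lborel_diff_right)
    have "(\<integral>x. \<bar>f (x - X n) - f x\<bar> \<partial>lborel)
        \<le> (\<integral>x. \<bar>f (x - X n) - g (x - X n)\<bar> + \<bar>g (x - X n) - g x\<bar> + \<bar>f x - g x\<bar> \<partial>lborel)"
      using i integrable_abs[OF Bochner_Integration.integrable_diff[OF integrable_lborel_diff_right[OF f] f], of "X n"]
      by (intro integral_mono Bochner_Integration.integrable_add) auto
    also have "\<dots> = (\<integral>x. \<bar>f (x - X n) - g (x - X n)\<bar> \<partial>lborel) + (\<integral>x. \<bar>g (x - X n) - g x\<bar> \<partial>lborel)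
        + (\<integral>x. \<bar>f x - g x\<bar> \<partial>lborel)"
      using i by simp
    also have "(\<integral>x. \<bar>f (x - X n) - g (x - X n)\<bar> \<partial>lborel) = (\<integral>x. \<bar>f x - g x\<bar> \<partial>lborel)"
      by (rule integral_lborel_diff_right[of "\<lambda>x. \<bar>f x - g x\<bar>"]) simp
    finally show ?thesis using g(2) N[OF that] \<open>e > 0\<close> by linarith
  qed
  then show "\<exists>no. \<forall>n\<ge>no. norm ((\<integral>x. \<bar>f (x - X n) - f x\<bar> \<partial>lborel) - 0) < e"
    by (intro exI[of _ N]) auto
qed

text \<open>Openness keeps \<open>x - X n\<close> in \<open>U\<close> eventually for each
  \<open>x\<close> in \<open>U\<close>, so the overlap of \<open>U\<close> with its translate tends
  to \<open>U\<close> pointwise. The boundary, where the translated indicator may fail to converge,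
  is harmless: the symmetric difference has measure twice that of \<open>U\<close> minus twice that
  of the overlap.\<close>

lemma L1_translation_continuous_open:
  fixes U :: "'a::euclidean_space set"
  assumes U: "open U" "emeasure lborel U < \<infinity>" and X: "X \<longlonglongrightarrow> 0"
  shows "(\<lambda>n. \<integral>x. \<bar>indicator U (x - X n) - indicator U x :: real\<bar> \<partial>lborel) \<longlonglongrightarrow> 0"
proof -
  have [measurable]: "U \<in> sets borel" using U by auto
  have i: "integrable lborel (indicator U :: 'a \<Rightarrow> real)"
    using U by (simp add: integrable_indicator_iff)
  have i2: "integrable lborel (\<lambda>x. indicator U x * indicator U (x - X n) :: real)" for n
    by (rule Bochner_Integration.integrable_bound[OF i]) (auto split: split_indicator)
  have "(\<lambda>n. \<integral>x. indicator U x * indicator U (x - X n) \<partial>lborel) \<longlonglongrightarrow> (\<integral>x. indicat_real U x \<partial>lborel)"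
  proof (rule integral_dominated_convergence[where w = "indicator U"])
    show "AE x in lborel. (\<lambda>n. indicator U x * indicator U (x - X n) :: real) \<longlonglongrightarrow> indicator U x"
    proof (rule AE_I2)
      fix x
      have "(\<lambda>n. x - X n) \<longlonglongrightarrow> x" using tendsto_diff[OF tendsto_const X, of x] by simp
      then have "\<forall>\<^sub>F n in sequentially. x - X n \<in> U" if "x \<in> U"
        using U that by (auto dest: topological_tendstoD)
      then have "\<forall>\<^sub>F n in sequentially. indicator U x * indicator U (x - X n) = (indicator U x :: real)"
        by (cases "x \<in> U") (auto elim!: eventually_mono)
      then show "(\<lambda>n. indicator U x * indicator U (x - X n) :: real) \<longlonglongrightarrow> indicator U x"
        by (rule tendsto_eventually)
    qed
  qed (use i in \<open>auto split: split_indicator\<close>)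
  then have "(\<lambda>n. 2 * (\<integral>x. indicat_real U x \<partial>lborel) - 2 * (\<integral>x. indicator U x * indicator U (x - X n) \<partial>lborel))
      \<longlonglongrightarrow> 2 * (\<integral>x. indicator U x \<partial>lborel) - 2 * (\<integral>x. indicat_real U x \<partial>lborel)"
    by (intro tendsto_intros)
  moreover have "(\<integral>x. \<bar>indicator U (x - X n) - indicator U x :: real\<bar> \<partial>lborel)
      = 2 * (\<integral>x. indicat_real U x \<partial>lborel) - 2 * (\<integral>x. indicator U x * indicator U (x - X n) \<partial>lborel)" for n
  proof -
    have "(\<integral>x. \<bar>indicator U (x - X n) - indicator U x :: real\<bar> \<partial>lborel)
        = (\<integral>x. indicator U (x - X n) + indicator U x - 2 * (indicator U x * indicator U (x - X n)) \<partial>lborel)"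
      by (intro Bochner_Integration.integral_cong) (auto split: split_indicator)
    also have "\<dots> = (\<integral>x. indicator U (x - X n) \<partial>lborel) + (\<integral>x. indicator U x \<partial>lborel)
        - 2 * (\<integral>x. indicator U x * indicator U (x - X n) \<partial>lborel)"
      using i i2[of n] integrable_lborel_diff_right[OF i, of "X n"] by simp
    also have "(\<integral>x. indicator U (x - X n) \<partial>lborel) = (\<integral>x. indicat_real U x \<partial>lborel)"
      by (rule integral_lborel_diff_right) simp
    finally show ?thesis by simp
  qed
  ultimately show ?thesis by simp
qed

lemma L1_translation_continuous:
  fixes f :: "'a::euclidean_space \<Rightarrow> real"
  assumes "integrable lborel f" and X: "X \<longlonglongrightarrow> 0"
  shows "(\<lambda>n. \<integral>x. \<bar>f (x - X n) - f x\<bar> \<partial>lborel) \<longlonglongrightarrow> 0"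
  using assms(1)
proof (induction rule: integrable_induct)
  case (base A c)
  have [measurable]: "A \<in> sets borel" using base by simp
  have iA: "integrable lborel (\<lambda>x. indicator A x *\<^sub>R c)"
    using base by (intro integrable_scaleR_left) (auto simp: integrable_indicator_iff)
  show ?case
  proof (rule L1_translation_continuous_approx[OF iA])
    fix e :: real assume "e > 0"
    \<comment> \<open>Outer regularity supplies the open set. Adding 1 to
      \<open>\<bar>c\<bar>\<close> keeps the quotient defined for \<open>c = 0\<close> and makes the
      final inequality strict.\<close>
    then obtain U where U: "open U" "A \<subseteq> U" "emeasure lebesgue (U - A) < ennreal (e / (\<bar>c\<bar> + 1))"
      using sets_lebesgue_outer_open[of A "e / (\<bar>c\<bar> + 1)"] base by (auto simp: sets_completionI_sets)
    have [measurable]: "U \<in> sets borel" using U by auto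
    have em: "emeasure lborel (U - A) < ennreal (e / (\<bar>c\<bar> + 1))" using U by simp
    have "emeasure lborel U = emeasure lborel A + emeasure lborel (U - A)"
      using U by (subst plus_emeasure) (auto intro!: arg_cong[where f = "emeasure lborel"])
    also have "\<dots> < \<infinity>" using base em by (simp add: less_top[symmetric]) (metis ennreal_less_top less_trans less_top)
    finally have Ufin: "emeasure lborel U < \<infinity>" .
    then have iU: "integrable lborel (indicator U :: 'a \<Rightarrow> real)" by (simp add: integrable_indicator_iff)
    have lim: "(\<lambda>n. \<bar>c\<bar> * (\<integral>x. \<bar>indicator U (x - X n) - indicator U x :: real\<bar> \<partial>lborel)) \<longlonglongrightarrow> \<bar>c\<bar> * 0"
      by (intro tendsto_intros L1_translation_continuous_open U Ufin X)
    have "(\<integral>x. \<bar>indicator A x *\<^sub>R c - indicator U x *\<^sub>R c\<bar> \<partial>lborel) = (\<integral>x. \<bar>c\<bar> * indicator (U - A) x \<partial>lborel)"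
      using U by (intro Bochner_Integration.integral_cong) (auto split: split_indicator)
    also have "\<dots> = \<bar>c\<bar> * measure lborel (U - A)" by simp
    also have "\<dots> \<le> \<bar>c\<bar> * (e / (\<bar>c\<bar> + 1))"
    proof (intro mult_left_mono)
      show "measure lborel (U - A) \<le> e / (\<bar>c\<bar> + 1)"
        unfolding measure_def using em \<open>e > 0\<close>
        by (intro enn2real_leI) (auto intro: less_imp_le)
    qed simp
    also have "\<dots> < e" using \<open>e > 0\<close> by (simp add: field_simps)
    finally have "(\<integral>x. \<bar>indicator A x *\<^sub>R c - indicator U x *\<^sub>R c\<bar> \<partial>lborel) < e" .
    moreover have "(\<lambda>n. \<integral>x. \<bar>indicator U (x - X n) *\<^sub>R c - indicator U x *\<^sub>R c\<bar> \<partial>lborel) \<longlonglongrightarrow> 0"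
      using lim by (simp add: abs_mult mult.commute[of "\<bar>c\<bar>"] flip: left_diff_distrib right_diff_distrib)
    ultimately show "\<exists>g. integrable lborel g \<and> (\<integral>x. \<bar>indicator A x *\<^sub>R c - g x\<bar> \<partial>lborel) < e \<and>
        (\<lambda>n. \<integral>x. \<bar>g (x - X n) - g x\<bar> \<partial>lborel) \<longlonglongrightarrow> 0"
      using iU by (intro exI[of _ "\<lambda>x. indicator U x *\<^sub>R c"] conjI integrable_scaleR_left) auto
  qed
next
  case (add f g)
  show ?case
  proof (rule Lim_null_comparison)
    show "(\<lambda>n. (\<integral>x. \<bar>f (x - X n) - f x\<bar> \<partial>lborel) + (\<integral>x. \<bar>g (x - X n) - g x\<bar> \<partial>lborel)) \<longlonglongrightarrow> 0"
      using tendsto_add[OF add(3,4)] by simp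
    have i: "integrable lborel (\<lambda>x. \<bar>h (x - X n) - h x\<bar>)" if "integrable lborel h" for h :: "'a \<Rightarrow> real" and n
      using that by (intro integrable_abs Bochner_Integration.integrable_diff integrable_lborel_diff_right)
    have "(\<integral>x. \<bar>(f (x - X n) + g (x - X n)) - (f x + g x)\<bar> \<partial>lborel)
        \<le> (\<integral>x. \<bar>f (x - X n) - f x\<bar> + \<bar>g (x - X n) - g x\<bar> \<partial>lborel)" for n
      using add i[OF Bochner_Integration.integrable_add[OF add(1,2)], of n]
      by (intro integral_mono Bochner_Integration.integrable_add i) auto
    also have "(\<integral>x. \<bar>f (x - X n) - f x\<bar> + \<bar>g (x - X n) - g x\<bar> \<partial>lborel)
        = (\<integral>x. \<bar>f (x - X n) - f x\<bar> \<partial>lborel) + (\<integral>x. \<bar>g (x - X n) - g x\<bar> \<partial>lborel)" for n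
      using add by (intro Bochner_Integration.integral_add i)
    finally show "\<forall>\<^sub>F n in sequentially. norm (\<integral>x. \<bar>(f (x - X n) + g (x - X n)) - (f x + g x)\<bar> \<partial>lborel)
        \<le> (\<integral>x. \<bar>f (x - X n) - f x\<bar> \<partial>lborel) + (\<integral>x. \<bar>g (x - X n) - g x\<bar> \<partial>lborel)"
      by (intro always_eventually) simp
  qed
next
  case (lim f s)
  show ?case
  proof (rule L1_translation_continuous_approx[OF \<open>integrable lborel f\<close>])
    fix e :: real assume "e > 0"
    have "(\<lambda>i. \<integral>x. \<bar>f x - s i x\<bar> \<partial>lborel) \<longlonglongrightarrow> (\<integral>x. 0 \<partial>(lborel :: 'a measure))"
    proof (rule integral_dominated_convergence[where w = "\<lambda>x. 3 * \<bar>f x\<bar>"])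
      show "AE x in lborel. (\<lambda>i. \<bar>f x - s i x\<bar>) \<longlonglongrightarrow> 0"
      proof (rule AE_I2)
        fix x :: 'a
        show "(\<lambda>i. \<bar>f x - s i x\<bar>) \<longlonglongrightarrow> 0"
          using tendsto_rabs[OF tendsto_diff[OF tendsto_const lim(2)], of x "f x"] by simp
      qed
      \<comment> \<open>The approximants in this induction satisfy
        \<open>\<bar>s i x\<bar> \<le> 2 * \<bar>f x\<bar>\<close>, which gives the factor
        3.\<close>
      show "AE x in lborel. norm \<bar>f x - s i x\<bar> \<le> 3 * \<bar>f x\<bar>" for i
        using lim(3)[of _ i] by (intro AE_I2) (fastforce simp: abs_if split: if_splits)
      show "integrable lborel (\<lambda>x. 3 * \<bar>f x\<bar>)" using \<open>integrable lborel f\<close> by simp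
    qed (use lim in auto)
    then obtain i where "(\<integral>x. \<bar>f x - s i x\<bar> \<partial>lborel) < e"
      using LIMSEQ_D[of _ 0 e] \<open>e > 0\<close> by fastforce
    then show "\<exists>g. integrable lborel g \<and> (\<integral>x. \<bar>f x - g x\<bar> \<partial>lborel) < e \<and>
        (\<lambda>n. \<integral>x. \<bar>g (x - X n) - g x\<bar> \<partial>lborel) \<longlonglongrightarrow> 0"
      using lim by blast
  qed
qed

text \<open>
  Reduced to \<open>L\<^sup>1\<close> by \<open>(u - v)\<^sup>2 \<le> |u\<^sup>2 - v\<^sup>2|\<close> for \<open>u, v \<ge> 0\<close>, applied to the positive and
  negative parts of the real and imaginary parts.
\<close>

lemma L2_translation_continuous:
  fixes f :: "'a::euclidean_space \<Rightarrow> complex"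
  assumes f: "f \<in> L2_space" and X: "X \<longlonglongrightarrow> 0"
  shows "(\<lambda>n. (L2_norm (\<lambda>x. f (x - X n) - f x))\<^sup>2) \<longlonglongrightarrow> 0"
proof -
  have [measurable]: "f \<in> borel_measurable borel" using f by (rule L2_space_measurable)
  define p :: "nat \<Rightarrow> complex \<Rightarrow> real" where
    "p i z = max 0 (if i = 0 then Re z else if i = 1 then - Re z else if i = 2 then Im z else - Im z)" for i z
  have [measurable]: "p i \<in> borel_measurable borel" for i
    unfolding p_def by measurable
  have pi: "integrable lborel (\<lambda>x. (p i (f x))\<^sup>2)" for i
  proof (rule Bochner_Integration.integrable_bound[OF L2_spaceD[OF f]])
    have "(p i z)\<^sup>2 \<le> (cmod z)\<^sup>2" for z
      using abs_Re_le_cmod[of z] abs_Im_le_cmod[of z] by (intro power_mono) (auto simp: p_def)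
    then show "AE x in lborel. norm ((p i (f x))\<^sup>2) \<le> norm ((cmod (f x))\<^sup>2)" by simp
  qed simp
  have real_sq: "(max 0 a - max 0 b)\<^sup>2 \<le> \<bar>(max 0 a)\<^sup>2 - (max 0 b)\<^sup>2\<bar>" for a b :: real
  proof -
    have "(u - v)\<^sup>2 \<le> \<bar>u\<^sup>2 - v\<^sup>2\<bar>" if "u \<ge> 0" "v \<ge> 0" for u v :: real
    proof -
      have "\<bar>u - v\<bar> * \<bar>u - v\<bar> \<le> \<bar>u - v\<bar> * \<bar>u + v\<bar>" using that by (intro mult_left_mono) auto
      then show ?thesis by (simp add: power2_eq_square square_diff_square_factored abs_mult mult.commute)
    qed
    then show ?thesis by simp
  qed
  have re_sq: "(a - b)\<^sup>2 \<le> 2 * \<bar>(max 0 a)\<^sup>2 - (max 0 b)\<^sup>2\<bar> + 2 * \<bar>(max 0 (-a))\<^sup>2 - (max 0 (-b))\<^sup>2\<bar>" for a b :: real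
  proof -
    define u v where "u = max 0 a - max 0 b" and "v = max 0 (-a) - max 0 (-b)"
    have "a - b = u - v" by (auto simp: u_def v_def max_def)
    then have "(a - b)\<^sup>2 \<le> 2 * u\<^sup>2 + 2 * v\<^sup>2"
      using zero_le_power2[of "u + v"] by (simp add: power2_sum power2_diff)
    then show ?thesis using real_sq[of a b] real_sq[of "-a" "-b"] unfolding u_def v_def by linarith
  qed
  have pt: "(cmod (a - b))\<^sup>2 \<le> 2 * (\<Sum>i<4. \<bar>(p i a)\<^sup>2 - (p i b)\<^sup>2\<bar>)" for a b
  proof -
    have "(\<Sum>i<4. h i) = h 0 + h 1 + h 2 + h (3::nat)" for h :: "nat \<Rightarrow> real"
      by (simp add: numeral_eq_Suc)
    then show ?thesis
      using re_sq[of "Re a" "Re b"] re_sq[of "Im a" "Im b"] by (simp add: cmod_power2 p_def)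
  qed
  have i: "integrable lborel (\<lambda>x. \<bar>(p i (f (x - X n)))\<^sup>2 - (p i (f x))\<^sup>2\<bar>)" for i n
    using pi integrable_lborel_diff_right[OF pi]
    by (intro integrable_abs Bochner_Integration.integrable_diff)
  show ?thesis
  proof (rule Lim_null_comparison)
    show "(\<lambda>n. 2 * (\<Sum>i<4. \<integral>x. \<bar>(p i (f (x - X n)))\<^sup>2 - (p i (f x))\<^sup>2\<bar> \<partial>lborel)) \<longlonglongrightarrow> 0"
      by (intro tendsto_mult_right_zero tendsto_null_sum L1_translation_continuous[OF pi X])
    have "(L2_norm (\<lambda>x. f (x - X n) - f x))\<^sup>2
        \<le> (\<integral>x. 2 * (\<Sum>i<4. \<bar>(p i (f (x - X n)))\<^sup>2 - (p i (f x))\<^sup>2\<bar>) \<partial>lborel)" for n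
      unfolding L2_norm_power2
    proof (rule integral_mono')
      show "integrable lborel (\<lambda>x. 2 * (\<Sum>i<4. \<bar>(p i (f (x - X n)))\<^sup>2 - (p i (f x))\<^sup>2\<bar>))"
        by (intro Bochner_Integration.integrable_mult_right Bochner_Integration.integrable_sum i)
    qed (use pt in auto)
    then show "\<forall>\<^sub>F n in sequentially. norm ((L2_norm (\<lambda>x. f (x - X n) - f x))\<^sup>2)
        \<le> 2 * (\<Sum>i<4. \<integral>x. \<bar>(p i (f (x - X n)))\<^sup>2 - (p i (f x))\<^sup>2\<bar> \<partial>lborel)"
      using i by (intro always_eventually) (simp add: Bochner_Integration.integral_sum)
  qed
qed

section \<open>Gaussians\<close>

text \<open>Lebesgue measure is the image of the product measure over the coordinates, so functions
  that factor along \<open>Basis\<close> reduce to one dimension. Complex values are allowed because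
  the integrand of a Fourier integral factors as well.\<close>

lemma
  fixes f :: "'a::euclidean_space \<Rightarrow> real \<Rightarrow> 'b::{real_normed_field,banach,second_countable_topology}"
  assumes f: "\<And>b. b \<in> Basis \<Longrightarrow> integrable lborel (f b)"
  shows integrable_lborel_prod_Basis: "integrable lborel (\<lambda>x. \<Prod>b\<in>Basis. f b (x \<bullet> b))"
    and integral_lborel_prod_Basis:
      "(\<integral>x. (\<Prod>b\<in>Basis. f b (x \<bullet> b)) \<partial>lborel) = (\<Prod>b\<in>Basis. \<integral>x. f b x \<partial>lborel)"
proof -
  interpret product_sigma_finite "\<lambda>_::'a. lborel :: real measure" ..
  have [measurable]: "f b \<in> borel_measurable borel" if "b \<in> Basis" for b
    using f[OF that] by auto
  have eq: "(\<Prod>b\<in>Basis. f b ((\<Sum>c\<in>Basis. y c *\<^sub>R c) \<bullet> b)) = (\<Prod>b\<in>Basis. f b (y b))" for y :: "'a \<Rightarrow> real"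
    by (intro prod.cong) auto
  have T [measurable]: "(\<lambda>f. \<Sum>b\<in>Basis. f b *\<^sub>R b) \<in> (\<Pi>\<^sub>M b\<in>Basis. lborel) \<rightarrow>\<^sub>M (borel :: 'a measure)"
    by measurable
  have "integrable (\<Pi>\<^sub>M b\<in>Basis. lborel) (\<lambda>y. \<Prod>b\<in>Basis. f b (y b))"
    by (rule product_integrable_prod) (use f in auto)
  then show "integrable lborel (\<lambda>x. \<Prod>b\<in>Basis. f b (x \<bullet> b))"
    by (subst lborel_eq, subst integrable_distr_eq) (simp_all add: eq)
  have "(\<integral>x. (\<Prod>b\<in>Basis. f b (x \<bullet> b)) \<partial>lborel) = (\<integral>y. (\<Prod>b\<in>Basis. f b (y b)) \<partial>(\<Pi>\<^sub>M b\<in>Basis. lborel))"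
    by (subst lborel_eq, subst integral_distr) (simp_all add: eq)
  also have "\<dots> = (\<Prod>b\<in>Basis. \<integral>x. f b x \<partial>lborel)"
    by (rule product_integral_prod) (use f in auto)
  finally show "(\<integral>x. (\<Prod>b\<in>Basis. f b (x \<bullet> b)) \<partial>lborel) = (\<Prod>b\<in>Basis. \<integral>x. f b x \<partial>lborel)" .
qed

text \<open>Both claims are rescalings of the standard normal law: its density gives integrability
  and its characteristic function the transform.\<close>

lemma
  fixes \<epsilon> \<eta> :: real
  assumes \<epsilon>: "\<epsilon> > 0"
  shows integrable_gaussian_real: "integrable lborel (\<lambda>x::real. exp (- (\<epsilon> * x\<^sup>2 / 2)))"
    and fourier_gaussian_real:
      "(\<integral>x. exp (- (\<i> * complex_of_real (x * \<eta>))) * complex_of_real (exp (- (\<epsilon> * x\<^sup>2 / 2))) \<partial>lborel)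
        = complex_of_real (sqrt (2 * pi / \<epsilon>) * exp (- (\<eta>\<^sup>2 / (2 * \<epsilon>))))"
proof -
  have "integrable lborel (\<lambda>x. sqrt (2 * pi / \<epsilon>) * normal_density 0 (1 / sqrt \<epsilon>) x)"
    using \<epsilon> by (intro Bochner_Integration.integrable_mult_right) simp
  moreover have "sqrt (2 * pi / \<epsilon>) * normal_density 0 (1 / sqrt \<epsilon>) x = exp (- (\<epsilon> * x\<^sup>2 / 2))" for x
    using \<epsilon> by (simp add: normal_density_def power_divide)
  ultimately show "integrable lborel (\<lambda>x::real. exp (- (\<epsilon> * x\<^sup>2 / 2)))" by simp
  \<comment> \<open>The frequency that becomes \<open>- \<eta>\<close> after the substitution of
    \<open>sqrt \<epsilon> * x\<close> for \<open>x\<close>.\<close>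
  define t where "t = - \<eta> / sqrt \<epsilon>"
  define g where "g x = exp (\<i> * complex_of_real (t * x)) * complex_of_real (exp (- (x\<^sup>2 / 2)))" for x
  have "complex_of_real (exp (- (t\<^sup>2) / 2)) = (\<integral>x. iexp (t * x) \<partial>std_normal_distribution)"
    using char_std_normal_distribution by (simp add: char_def fun_eq_iff)
  also have "\<dots> = (\<integral>x. std_normal_density x *\<^sub>R iexp (t * x) \<partial>lborel)"
    by (subst integral_density) auto
  also have "\<dots> = (\<integral>x. complex_of_real (1 / sqrt (2 * pi)) * g x \<partial>lborel)"
    by (intro Bochner_Integration.integral_cong) (auto simp: g_def normal_density_def scaleR_conv_of_real)
  also have "\<dots> = complex_of_real (1 / sqrt (2 * pi)) * (\<integral>x. g x \<partial>lborel)" by simp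
  also have "(\<integral>x. g x \<partial>lborel) = complex_of_real (sqrt \<epsilon>) * (\<integral>x. g (sqrt \<epsilon> * x) \<partial>lborel)"
    using lborel_integral_real_affine[of "sqrt \<epsilon>" g 0] \<epsilon> by (simp add: scaleR_conv_of_real)
  also have "(\<integral>x. g (sqrt \<epsilon> * x) \<partial>lborel)
      = (\<integral>x. exp (- (\<i> * complex_of_real (x * \<eta>))) * complex_of_real (exp (- (\<epsilon> * x\<^sup>2 / 2))) \<partial>lborel)"
    using \<epsilon> by (simp add: g_def t_def power_mult_distrib mult.commute mult.left_commute)
  finally have "complex_of_real (exp (- (t\<^sup>2) / 2)) = complex_of_real (sqrt \<epsilon> / sqrt (2 * pi)) *
      (\<integral>x. exp (- (\<i> * complex_of_real (x * \<eta>))) * complex_of_real (exp (- (\<epsilon> * x\<^sup>2 / 2))) \<partial>lborel)"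
    by simp
  moreover have "- (t\<^sup>2) / 2 = - (\<eta>\<^sup>2 / (2 * \<epsilon>))" using \<epsilon> by (simp add: t_def power_divide)
  moreover have "sqrt (2 * pi / \<epsilon>) * (sqrt \<epsilon> / sqrt (2 * pi)) = 1"
    using \<epsilon> by (simp add: real_sqrt_divide)
  ultimately show "(\<integral>x. exp (- (\<i> * complex_of_real (x * \<eta>))) * complex_of_real (exp (- (\<epsilon> * x\<^sup>2 / 2))) \<partial>lborel)
        = complex_of_real (sqrt (2 * pi / \<epsilon>) * exp (- (\<eta>\<^sup>2 / (2 * \<epsilon>))))"
    by (metis (no_types, lifting) mult.assoc mult_1 of_real_1 of_real_mult)
qed

text \<open>The parameter is an inverse variance: small \<open>\<epsilon>\<close> means a wide
  Gaussian, and the Fourier transform exchanges \<open>\<epsilon>\<close> and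
  \<open>1 / \<epsilon>\<close> up to a factor.\<close>

definition gaussian :: "real \<Rightarrow> 'a::euclidean_space \<Rightarrow> real" where
  "gaussian \<epsilon> x = exp (- (\<epsilon> * (norm x)\<^sup>2 / 2))"

lemma gaussian_eq_prod: "gaussian \<epsilon> x = (\<Prod>b\<in>Basis. exp (- (\<epsilon> * (x \<bullet> b)\<^sup>2 / 2)))"
proof -
  have "(norm x)\<^sup>2 = (\<Sum>b\<in>Basis. (x \<bullet> b)\<^sup>2)"
    by (simp only: power2_norm_eq_inner euclidean_inner[of x x]) (simp add: power2_eq_square)
  then show ?thesis
    unfolding gaussian_def exp_sum[OF finite_Basis, symmetric]
    by (simp add: sum_negf sum_distrib_left flip: sum_divide_distrib)
qed

lemma integrable_gaussian: "\<epsilon> > 0 \<Longrightarrow> integrable lborel (gaussian \<epsilon> :: 'a::euclidean_space \<Rightarrow> real)"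
  unfolding gaussian_eq_prod[abs_def]
  by (intro integrable_lborel_prod_Basis integrable_gaussian_real)

lemma fourier_integral_gaussian:
  fixes \<xi> :: "'a::euclidean_space"
  assumes "\<epsilon> > 0"
  shows "fourier_integral (\<lambda>x. complex_of_real (gaussian \<epsilon> x)) \<xi>
    = complex_of_real (sqrt (2 * pi / \<epsilon>) ^ DIM('a) * gaussian (1 / \<epsilon>) \<xi>)"
proof -
  have "exp (- (\<i> * complex_of_real (x \<bullet> \<xi>))) * complex_of_real (gaussian \<epsilon> x)
      = (\<Prod>b\<in>Basis. exp (- (\<i> * complex_of_real ((x \<bullet> b) * (\<xi> \<bullet> b)))) * complex_of_real (exp (- (\<epsilon> * (x \<bullet> b)\<^sup>2 / 2))))" for x
    unfolding prod.distrib of_real_prod[symmetric] gaussian_eq_prod[symmetric]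
    unfolding exp_sum[OF finite_Basis, symmetric]
    by (simp add: euclidean_inner[of x \<xi>] sum_negf sum_distrib_left)
  then have "fourier_integral (\<lambda>x. complex_of_real (gaussian \<epsilon> x)) \<xi>
      = (\<integral>x. (\<Prod>b\<in>Basis. exp (- (\<i> * complex_of_real ((x \<bullet> b) * (\<xi> \<bullet> b)))) * complex_of_real (exp (- (\<epsilon> * (x \<bullet> b)\<^sup>2 / 2)))) \<partial>lborel)"
    by (simp add: fourier_integral_def)
  also have "\<dots> = (\<Prod>b\<in>Basis. \<integral>x. exp (- (\<i> * complex_of_real (x * (\<xi> \<bullet> b)))) * complex_of_real (exp (- (\<epsilon> * x\<^sup>2 / 2))) \<partial>lborel)"
  proof (rule integral_lborel_prod_Basis)
    fix b
    show "integrable lborel (\<lambda>x. exp (- (\<i> * complex_of_real (x * (\<xi> \<bullet> b)))) * complex_of_real (exp (- (\<epsilon> * x\<^sup>2 / 2))))"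
      by (rule Bochner_Integration.integrable_bound[OF integrable_gaussian_real[OF assms]])
         (auto simp: norm_mult)
  qed
  also have "\<dots> = complex_of_real (\<Prod>b\<in>Basis. sqrt (2 * pi / \<epsilon>) * exp (- ((\<xi> \<bullet> b)\<^sup>2 / (2 * \<epsilon>))))"
    by (simp only: fourier_gaussian_real[OF assms] of_real_prod)
  also have "(\<Prod>b\<in>Basis. sqrt (2 * pi / \<epsilon>) * exp (- ((\<xi> \<bullet> b)\<^sup>2 / (2 * \<epsilon>))))
      = sqrt (2 * pi / \<epsilon>) ^ DIM('a) * gaussian (1 / \<epsilon>) \<xi>"
    by (simp add: prod.distrib gaussian_eq_prod mult.commute)
  finally show ?thesis .
qed

lemma integral_gaussian:
  assumes "\<epsilon> > 0"
  shows "(\<integral>x. gaussian \<epsilon> (x::'a::euclidean_space) \<partial>lborel) = sqrt (2 * pi / \<epsilon>) ^ DIM('a)"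
proof -
  have "complex_of_real (\<integral>x. gaussian \<epsilon> (x::'a) \<partial>lborel) = complex_of_real (sqrt (2 * pi / \<epsilon>) ^ DIM('a))"
    using fourier_integral_gaussian[OF assms, of "0 :: 'a"]
    by (simp add: fourier_integral_def gaussian_def)
  then show ?thesis by (simp only: of_real_eq_iff)
qed

section \<open>Plancherel on \<open>L\<^sup>1 \<inter> L\<^sup>2\<close>\<close>

lemma integral_lborel_scaleR:
  fixes f :: "'a::euclidean_space \<Rightarrow> 'b::{banach, second_countable_topology}"
  assumes [measurable]: "f \<in> borel_measurable borel" and c: "c \<noteq> 0"
  shows "(\<integral>x. f x \<partial>lborel) = (\<integral>x. \<bar>c\<bar> ^ DIM('a) *\<^sub>R f (c *\<^sub>R x) \<partial>lborel)"
  using lborel_affine[OF c, of "0 :: 'a"]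
  by (subst (asm) distr_cong[of _ _ borel borel, where g = "\<lambda>x. c *\<^sub>R x"], simp_all)
     (subst (1) \<open>lborel = _\<close>, subst integral_density, simp_all add: integral_distr)

lemma L1_space_measurable [measurable_dest]: "f \<in> L1_space \<Longrightarrow> f \<in> borel_measurable borel"
  by (auto simp: L1_space_def)

lemma L1_spaceD: "f \<in> L1_space \<Longrightarrow> integrable lborel f"
  by (simp add: L1_space_def)

lemma borel_measurable_fourier_integral [measurable]:
  assumes [measurable]: "f \<in> borel_measurable borel"
  shows "fourier_integral f \<in> borel_measurable borel"
  unfolding fourier_integral_def by measurable

lemma integrable_fourier_integrand:
  assumes "integrable lborel f"
  shows "integrable lborel (\<lambda>x. exp (- (\<i> * complex_of_real (x \<bullet> \<xi>))) * f x)"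
  by (rule Bochner_Integration.integrable_bound[OF assms])
     (use assms in \<open>auto simp: norm_mult\<close>)

lemma cmod_fourier_integral_le:
  assumes "f \<in> L1_space"
  shows "cmod (fourier_integral f \<xi>) \<le> L1_norm f"
proof -
  have "cmod (fourier_integral f \<xi>) \<le> (\<integral>x. cmod (exp (- (\<i> * complex_of_real (x \<bullet> \<xi>))) * f x) \<partial>lborel)"
    unfolding fourier_integral_def by (rule integral_norm_bound)
  then show ?thesis by (simp add: norm_mult L1_norm_def)
qed

lemma fourier_integral_diff:
  assumes "f \<in> L1_space" "g \<in> L1_space"
  shows "fourier_integral (\<lambda>x. f x - g x) \<xi> = fourier_integral f \<xi> - fourier_integral g \<xi>"
  unfolding fourier_integral_def right_diff_distrib
  using assms by (intro Bochner_Integration.integral_diff integrable_fourier_integrand L1_spaceD)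

lemma fourier_integral_add:
  assumes "f \<in> L1_space" "g \<in> L1_space"
  shows "fourier_integral (\<lambda>x. f x + g x) \<xi> = fourier_integral f \<xi> + fourier_integral g \<xi>"
  unfolding fourier_integral_def distrib_left
  using assms by (intro Bochner_Integration.integral_add integrable_fourier_integrand L1_spaceD)

lemma fourier_integral_cmult:
  "fourier_integral (\<lambda>x. c * f x) \<xi> = c * fourier_integral f \<xi>"
  by (simp add: fourier_integral_def mult.left_commute)

text \<open>The kernel is symmetric in \<open>x\<close> and \<open>\<xi>\<close> and has modulus 1,
  so Fubini applies to integrable \<open>f\<close> and \<open>g\<close> and moves the transform from
  one to the other.\<close>

lemma integral_fourier_integral_mult:
  assumes f: "f \<in> L1_space" and g: "g \<in> L1_space"
  shows "(\<integral>\<xi>. fourier_integral f \<xi> * g \<xi> \<partial>lborel) = (\<integral>x. f x * fourier_integral g x \<partial>lborel)"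
proof -
  note [measurable] = L1_space_measurable[OF f] L1_space_measurable[OF g]
  let ?h = "\<lambda>x \<xi>. exp (- (\<i> * complex_of_real (x \<bullet> \<xi>))) * f x * g \<xi>"
  have "integrable (lborel \<Otimes>\<^sub>M lborel) (\<lambda>(x, \<xi>). ?h x \<xi>)"
  proof (rule lborel_pair.Fubini_integrable)
    show "integrable lborel (\<lambda>x. \<integral>\<xi>. norm (case (x, \<xi>) of (x, \<xi>) \<Rightarrow> ?h x \<xi>) \<partial>lborel)"
      using L1_spaceD[OF f] by (simp add: norm_mult)
    show "AE x in lborel. integrable lborel (\<lambda>\<xi>. case (x, \<xi>) of (x, \<xi>) \<Rightarrow> ?h x \<xi>)"
    proof (rule AE_I2)
      fix x
      show "integrable lborel (\<lambda>\<xi>. case (x, \<xi>) of (x, \<xi>) \<Rightarrow> ?h x \<xi>)"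
        by (rule Bochner_Integration.integrable_bound[of _ "\<lambda>\<xi>. f x * g \<xi>"])
           (use L1_spaceD[OF g] in \<open>auto simp: norm_mult\<close>)
    qed
  qed measurable
  from lborel_pair.Fubini_integral[OF this]
  have "(\<integral>\<xi>. \<integral>x. ?h x \<xi> \<partial>lborel \<partial>lborel) = (\<integral>x. \<integral>\<xi>. ?h x \<xi> \<partial>lborel \<partial>lborel)" .
  moreover have "(\<integral>x. ?h x \<xi> \<partial>lborel) = fourier_integral f \<xi> * g \<xi>" for \<xi>
    unfolding fourier_integral_def by simp
  moreover have "(\<integral>\<xi>. ?h x \<xi> \<partial>lborel) = f x * fourier_integral g x" for x
    unfolding fourier_integral_def by (simp add: inner_commute mult.commute mult.left_commute flip: integral_mult_right_zero)
  ultimately show ?thesis by (simp only:)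
qed

section \<open>Gaussian regularisation of the square of the transform\<close>

lemma gaussian_pos: "gaussian \<epsilon> x > 0"
  by (simp add: gaussian_def)

lemma borel_measurable_gaussian [measurable]: "gaussian \<epsilon> \<in> borel_measurable borel"
  unfolding gaussian_def by measurable

text \<open>Modulation shifts the transform; evenness of the Gaussian permits writing the shift as
  \<open>x - y\<close>, the form of a convolution kernel.\<close>

lemma fourier_integral_gaussian_modulated:
  fixes x y :: "'a::euclidean_space"
  assumes "\<epsilon> > 0"
  shows "fourier_integral (\<lambda>\<xi>. complex_of_real (gaussian \<epsilon> \<xi>) * exp (\<i> * complex_of_real (\<xi> \<bullet> x))) y
    = complex_of_real (sqrt (2 * pi / \<epsilon>) ^ DIM('a) * gaussian (1 / \<epsilon>) (x - y))"
proof -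
  have "fourier_integral (\<lambda>\<xi>. complex_of_real (gaussian \<epsilon> \<xi>) * exp (\<i> * complex_of_real (\<xi> \<bullet> x))) y
      = fourier_integral (\<lambda>\<xi>. complex_of_real (gaussian \<epsilon> \<xi>)) (y - x)"
    unfolding fourier_integral_def
    by (intro Bochner_Integration.integral_cong)
       (simp_all add: inner_diff_right right_diff_distrib mult_ac flip: exp_add)
  also have "gaussian (1 / \<epsilon>) (y - x) = gaussian (1 / \<epsilon>) (x - y)"
    by (simp add: gaussian_def norm_minus_commute)
  then have "fourier_integral (\<lambda>\<xi>. complex_of_real (gaussian \<epsilon> \<xi>)) (y - x)
      = complex_of_real (sqrt (2 * pi / \<epsilon>) ^ DIM('a) * gaussian (1 / \<epsilon>) (x - y))"
    by (simp only: fourier_integral_gaussian[OF assms])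
  finally show ?thesis .
qed

text \<open>The multiplication formula is used twice. The transform of \<open>f\<close> is only
  known to be bounded here, so the Gaussian factor is what makes \<open>g\<close> integrable; its
  own transform then follows from the formula for \<open>f\<close> and a modulated Gaussian, and is
  a convolution of \<open>G\<close> with the conjugate of \<open>f\<close>.\<close>

lemma integral_fourier_gaussian_damped_convolution:
  fixes f :: "'a::euclidean_space \<Rightarrow> complex"
  assumes f: "f \<in> L1_space" and \<epsilon>: "\<epsilon> > 0"
  defines "G \<equiv> \<lambda>z. sqrt (2 * pi / \<epsilon>) ^ DIM('a) * gaussian (1 / \<epsilon>) (z :: 'a)"
  shows "complex_of_real (\<integral>\<xi>. (cmod (fourier_integral f \<xi>))\<^sup>2 * gaussian \<epsilon> \<xi> \<partial>lborel)
    = (\<integral>x. \<integral>z. complex_of_real (G z) * (f x * cnj (f (x - z))) \<partial>lborel \<partial>lborel)"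
proof -
  note [measurable] = L1_space_measurable[OF f]
  define g where "g \<xi> = complex_of_real (gaussian \<epsilon> \<xi>) * cnj (fourier_integral f \<xi>)" for \<xi>
  have g: "g \<in> L1_space"
    unfolding L1_space_def mem_Collect_eq
  proof (rule Bochner_Integration.integrable_bound)
    show "integrable lborel (\<lambda>\<xi>::'a. L1_norm f * gaussian \<epsilon> \<xi>)"
      by (intro Bochner_Integration.integrable_mult_right integrable_gaussian \<epsilon>)
    have "norm (g \<xi>) \<le> L1_norm f * gaussian \<epsilon> \<xi>" for \<xi>
      using cmod_fourier_integral_le[OF f, of \<xi>] gaussian_pos[of \<epsilon> \<xi>]
      by (simp add: g_def norm_mult mult.commute[of "gaussian _ _"])
    then show "AE \<xi> in lborel. norm (g \<xi>) \<le> norm (L1_norm f * gaussian \<epsilon> \<xi>)"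
      by (intro AE_I2) (metis abs_ge_self order_trans real_norm_def)
  qed (unfold g_def, measurable)
  have inner: "f x * fourier_integral g x = (\<integral>z. complex_of_real (G z) * (f x * cnj (f (x - z))) \<partial>lborel)" for x
  proof -
    let ?m = "\<lambda>\<xi>. complex_of_real (gaussian \<epsilon> \<xi>) * exp (\<i> * complex_of_real (\<xi> \<bullet> x))"
    have m: "?m \<in> L1_space"
      unfolding L1_space_def mem_Collect_eq
      by (rule Bochner_Integration.integrable_bound[OF integrable_gaussian[OF \<epsilon>]])
         (auto simp: norm_mult)
    have "fourier_integral g x = (\<integral>\<xi>. cnj (fourier_integral f \<xi> * ?m \<xi>) \<partial>lborel)"
      unfolding fourier_integral_def[of g] g_def
      by (intro Bochner_Integration.integral_cong) (simp_all add: exp_cnj mult_ac)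
    also have "\<dots> = cnj (\<integral>\<xi>. fourier_integral f \<xi> * ?m \<xi> \<partial>lborel)"
      by (rule Bochner_Integration.integral_cnj)
    also have "\<dots> = cnj (\<integral>y. f y * complex_of_real (G (x - y)) \<partial>lborel)"
      unfolding integral_fourier_integral_mult[OF f m] fourier_integral_gaussian_modulated[OF \<epsilon>] G_def ..
    also have "(\<integral>y. f y * complex_of_real (G (x - y)) \<partial>lborel)
        = (\<integral>z. f (x - z) * complex_of_real (G z) \<partial>lborel)"
      by (subst integral_lborel_diff_left[symmetric, of _ x]) (simp_all add: G_def)
    finally have "fourier_integral g x = (\<integral>z. cnj (f (x - z) * complex_of_real (G z)) \<partial>lborel)"
      by (simp only: Bochner_Integration.integral_cnj)
    then show ?thesis by (simp add: mult_ac flip: integral_mult_right_zero)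
  qed
  have "complex_of_real (\<integral>\<xi>. (cmod (fourier_integral f \<xi>))\<^sup>2 * gaussian \<epsilon> \<xi> \<partial>lborel)
      = (\<integral>\<xi>. complex_of_real ((cmod (fourier_integral f \<xi>))\<^sup>2 * gaussian \<epsilon> \<xi>) \<partial>lborel)"
    by (rule integral_complex_of_real[symmetric])
  also have "\<dots> = (\<integral>\<xi>. fourier_integral f \<xi> * g \<xi> \<partial>lborel)"
    unfolding g_def by (intro Bochner_Integration.integral_cong) (simp_all only: of_real_mult complex_norm_square mult_ac)
  also have "\<dots> = (\<integral>x. f x * fourier_integral g x \<partial>lborel)"
    by (rule integral_fourier_integral_mult[OF f g])
  finally show ?thesis unfolding inner .
qed

lemma L2_space_diff_right: "f \<in> L2_space \<Longrightarrow> (\<lambda>x. f (x - z)) \<in> L2_space"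
  unfolding L2_space_def using integrable_lborel_diff_right[of "\<lambda>x. (cmod (f x))\<^sup>2" z]
  by (auto intro: measurable_compose[of "\<lambda>x. x - z" borel borel])

lemma L2_norm_diff_right: "f \<in> L2_space \<Longrightarrow> L2_norm (\<lambda>x. f (x - z)) = L2_norm f"
  unfolding L2_norm_def
  by (subst integral_lborel_diff_right[of "\<lambda>x. (cmod (f x))\<^sup>2"]) auto

text \<open>Exchanging the integrals leaves, for each \<open>z\<close>, the inner product of
  \<open>f\<close> with its translate. Since both have the same norm, polarisation expresses its
  real part through the norm of their difference, which is small for small \<open>z\<close>.\<close>

lemma integral_fourier_gaussian_damped:
  fixes f :: "'a::euclidean_space \<Rightarrow> complex"
  assumes f: "f \<in> L1_space" "f \<in> L2_space" and \<epsilon>: "\<epsilon> > 0"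
  defines "G \<equiv> \<lambda>z. sqrt (2 * pi / \<epsilon>) ^ DIM('a) * gaussian (1 / \<epsilon>) (z :: 'a)"
  shows "(\<integral>\<xi>. (cmod (fourier_integral f \<xi>))\<^sup>2 * gaussian \<epsilon> \<xi> \<partial>lborel)
    = (\<integral>z. G z * ((L2_norm f)\<^sup>2 - (L2_norm (\<lambda>x. f (x - z) - f x))\<^sup>2 / 2) \<partial>lborel)"
proof -
  note [measurable] = L1_space_measurable[OF f(1)]
  have [measurable]: "G \<in> borel_measurable borel" unfolding G_def by measurable
  have G0: "G z \<ge> 0" for z
    using \<epsilon> gaussian_pos[of "1 / \<epsilon>" z] by (simp add: G_def)
  have iG: "integrable lborel G"
    unfolding G_def by (intro Bochner_Integration.integrable_mult_right integrable_gaussian) (use \<epsilon> in simp)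
  let ?h = "\<lambda>z x. complex_of_real (G z) * (f x * cnj (f (x - z)))"
  let ?N = "(L2_norm f)\<^sup>2"
  have prod_int: "integrable lborel (\<lambda>x. f x * cnj (f (x - z)))" for z
    using f by (intro L2_space_mult_integrable L2_space_cnj L2_space_diff_right)
  have h_int: "integrable lborel (?h z)" for z
    by (intro Bochner_Integration.integrable_mult_right prod_int)
  have hh: "integrable (lborel \<Otimes>\<^sub>M lborel) (\<lambda>(z, x). ?h z x)"
  proof (rule lborel_pair.Fubini_integrable)
    show "integrable lborel (\<lambda>z. \<integral>x. norm (case (z, x) of (z, x) \<Rightarrow> ?h z x) \<partial>lborel)"
    proof (rule Bochner_Integration.integrable_bound)
      show "integrable lborel (\<lambda>z. ?N * G z)" by (intro Bochner_Integration.integrable_mult_right iG)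
      have "(\<integral>x. norm (?h z x) \<partial>lborel) \<le> ?N * G z" for z
      proof -
        have "(\<integral>x. norm (?h z x) \<partial>lborel) \<le> (\<integral>x. G z * ((cmod (f x))\<^sup>2 / 2 + (cmod (f (x - z)))\<^sup>2 / 2) \<partial>lborel)"
        proof (rule integral_mono)
          show "norm (?h z x) \<le> G z * ((cmod (f x))\<^sup>2 / 2 + (cmod (f (x - z)))\<^sup>2 / 2)" for x
            using sum_squares_bound[of "cmod (f x)" "cmod (f (x - z))"] G0[of z]
            by (auto simp: norm_mult intro!: mult_left_mono)
        qed (use h_int f in \<open>auto intro!: L2_spaceD L2_space_diff_right\<close>)
        also have "\<dots> = ?N * G z"
          using f L2_norm_diff_right[OF f(2), of z] L2_spaceD[OF f(2)] L2_spaceD[OF L2_space_diff_right[OF f(2)], of z]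
            L2_norm_power2[of f] L2_norm_power2[of "\<lambda>x. f (x - z)"]
          by simp
        finally show ?thesis .
      qed
      then show "AE z in lborel. norm (\<integral>x. norm (case (z, x) of (z, x) \<Rightarrow> ?h z x) \<partial>lborel) \<le> norm (?N * G z)"
        using G0 by (intro AE_I2) (simp add: abs_of_nonneg)
    qed measurable
    show "AE z in lborel. integrable lborel (\<lambda>x. case (z, x) of (z, x) \<Rightarrow> ?h z x)"
      using h_int by simp
  qed measurable
  from lborel_pair.Fubini_integral[OF hh]
  have "(\<integral>x. \<integral>z. ?h z x \<partial>lborel \<partial>lborel) = (\<integral>z. \<integral>x. ?h z x \<partial>lborel \<partial>lborel)"
    and int: "integrable lborel (\<lambda>z. \<integral>x. ?h z x \<partial>lborel)"
    using lborel_pair.integrable_fst'[OF hh] by simp_all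
  then have "complex_of_real (\<integral>\<xi>. (cmod (fourier_integral f \<xi>))\<^sup>2 * gaussian \<epsilon> \<xi> \<partial>lborel)
      = (\<integral>z. \<integral>x. ?h z x \<partial>lborel \<partial>lborel)"
    unfolding integral_fourier_gaussian_damped_convolution[OF f(1) \<epsilon>] G_def by simp
  then have "(\<integral>\<xi>. (cmod (fourier_integral f \<xi>))\<^sup>2 * gaussian \<epsilon> \<xi> \<partial>lborel)
      = Re (\<integral>z. \<integral>x. ?h z x \<partial>lborel \<partial>lborel)"
    by (metis Re_complex_of_real)
  also have "\<dots> = (\<integral>z. Re (\<integral>x. ?h z x \<partial>lborel) \<partial>lborel)"
    by (rule integral_Re[OF int, symmetric])
  also have "\<dots> = (\<integral>z. G z * (?N - (L2_norm (\<lambda>x. f (x - z) - f x))\<^sup>2 / 2) \<partial>lborel)"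
  proof (intro Bochner_Integration.integral_cong refl)
    fix z
    have "Re (\<integral>x. ?h z x \<partial>lborel) = G z * Re (\<integral>x. f x * cnj (f (x - z)) \<partial>lborel)"
      by simp
    moreover have "(L2_norm (\<lambda>x. f (x - z) - f x))\<^sup>2 = 2 * ?N - 2 * Re (\<integral>x. f x * cnj (f (x - z)) \<partial>lborel)"
      using L2_norm_diff_power2[OF f(2) L2_space_diff_right[OF f(2)], of z]
      by (simp add: L2_norm_diff_right f L2_norm_minus_commute[of f])
    ultimately show "Re (\<integral>x. ?h z x \<partial>lborel) = G z * (?N - (L2_norm (\<lambda>x. f (x - z) - f x))\<^sup>2 / 2)"
      by (simp add: diff_divide_distrib)
  qed
  finally show ?thesis .
qed

text \<open>After rescaling, the narrow Gaussian becomes a fixed one and the translations shrink to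
  0, so dominated convergence gives the limit on the right. On the left the weights increase to 1,
  and monotone convergence yields square integrability of the transform together with the value of
  its norm.\<close>

lemma
  fixes f :: "'a::euclidean_space \<Rightarrow> complex"
  assumes f: "f \<in> L1_space" "f \<in> L2_space"
  shows L2_space_fourier_integral: "fourier_integral f \<in> L2_space"
    and Plancherel_L1_L2: "(L2_norm (fourier_integral f))\<^sup>2 = (2 * pi) ^ DIM('a) * (L2_norm f)\<^sup>2"
proof -
  note [measurable] = L1_space_measurable[OF f(1)]
  let ?N = "(L2_norm f)\<^sup>2"
  define D where "D z = (L2_norm (\<lambda>x. f (x - z) - f x))\<^sup>2" for z
  \<comment> \<open>This choice makes \<open>1 / sqrt (\<epsilon> n)\<close> equal to
    \<open>Suc n\<close>, so the substitution below scales by \<open>1 / Suc n\<close>. It also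
    decreases in \<open>n\<close>, as monotone convergence requires.\<close>
  define \<epsilon> where "\<epsilon> n = 1 / (real (Suc n))\<^sup>2" for n
  have \<epsilon>: "\<epsilon> n > 0" for n by (simp add: \<epsilon>_def)
  have [measurable]: "D \<in> borel_measurable borel"
    unfolding D_def L2_norm_power2 by measurable
  have D4: "D z \<le> 4 * ?N" for z
  proof -
    have "L2_norm (\<lambda>x. f (x - z) - f x) \<le> 2 * L2_norm f"
      using L2_norm_triangle[OF L2_space_diff_right[OF f(2)] L2_space_cmult[OF f(2)], of z "-1"]
        L2_norm_diff_right[OF f(2), of z] L2_norm_cmult[of "-1" f]
      by simp
    then have "D z \<le> (2 * L2_norm f)\<^sup>2" unfolding D_def by (intro power_mono) auto
    then show ?thesis by (simp add: power_mult_distrib)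
  qed
  have damped: "(\<integral>\<xi>. (cmod (fourier_integral f \<xi>))\<^sup>2 * gaussian (\<epsilon> n) \<xi> \<partial>lborel)
      = sqrt (2 * pi) ^ DIM('a) * (\<integral>w. gaussian 1 w * (?N - D (w /\<^sub>R Suc n) / 2) \<partial>lborel)" for n
  proof -
    have "(\<integral>\<xi>. (cmod (fourier_integral f \<xi>))\<^sup>2 * gaussian (\<epsilon> n) \<xi> \<partial>lborel)
      = (\<integral>z. sqrt (2 * pi / \<epsilon> n) ^ DIM('a) * gaussian (1 / \<epsilon> n) z * (?N - D z / 2) \<partial>lborel)"
      unfolding integral_fourier_gaussian_damped[OF f \<epsilon>] D_def ..
    also have "\<dots> = (\<integral>w. \<bar>inverse (real (Suc n))\<bar> ^ DIM('a) *\<^sub>R (sqrt (2 * pi / \<epsilon> n) ^ DIM('a) *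
        gaussian (1 / \<epsilon> n) (w /\<^sub>R Suc n) * (?N - D (w /\<^sub>R Suc n) / 2)) \<partial>lborel)"
      by (rule integral_lborel_scaleR) auto
    also have "\<dots> = (\<integral>w. sqrt (2 * pi) ^ DIM('a) * (gaussian 1 w * (?N - D (w /\<^sub>R Suc n) / 2)) \<partial>lborel)"
    proof (intro Bochner_Integration.integral_cong refl)
      fix w :: 'a
      have "gaussian (1 / \<epsilon> n) (w /\<^sub>R Suc n) = gaussian 1 w"
        by (simp add: gaussian_def \<epsilon>_def power_mult_distrib del: of_nat_Suc)
           (simp add: field_simps del: of_nat_Suc)
      moreover have "\<bar>inverse (real (Suc n))\<bar> ^ DIM('a) * sqrt (2 * pi / \<epsilon> n) ^ DIM('a) = sqrt (2 * pi) ^ DIM('a)"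
        by (simp add: \<epsilon>_def real_sqrt_mult field_simps del: of_nat_Suc flip: power_mult_distrib)
      ultimately show "\<bar>inverse (real (Suc n))\<bar> ^ DIM('a) *\<^sub>R (sqrt (2 * pi / \<epsilon> n) ^ DIM('a) *
        gaussian (1 / \<epsilon> n) (w /\<^sub>R Suc n) * (?N - D (w /\<^sub>R Suc n) / 2))
        = sqrt (2 * pi) ^ DIM('a) * (gaussian 1 w * (?N - D (w /\<^sub>R Suc n) / 2))"
        by (simp only: real_scaleR_def mult.assoc[symmetric])
    qed
    finally show ?thesis by simp
  qed
  have "(\<lambda>n. \<integral>w. gaussian 1 w * (?N - D (w /\<^sub>R Suc n) / 2) \<partial>lborel) \<longlonglongrightarrow> (\<integral>w. gaussian 1 (w::'a) * ?N \<partial>lborel)"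
  proof (rule integral_dominated_convergence[where w = "\<lambda>w. gaussian 1 w * (3 * ?N)"])
    show "AE w in lborel. (\<lambda>n. gaussian 1 w * (?N - D (w /\<^sub>R Suc n) / 2)) \<longlonglongrightarrow> gaussian 1 w * ?N"
    proof (rule AE_I2)
      fix w :: 'a
      have "(\<lambda>n. inverse (real (Suc n)) *\<^sub>R w) \<longlonglongrightarrow> 0 *\<^sub>R w"
        by (intro tendsto_intros LIMSEQ_inverse_real_of_nat)
      then have "(\<lambda>n. D (w /\<^sub>R Suc n)) \<longlonglongrightarrow> 0"
        unfolding D_def by (intro L2_translation_continuous f) simp
      then have "(\<lambda>n. gaussian 1 w * (?N - D (w /\<^sub>R Suc n) / 2)) \<longlonglongrightarrow> gaussian 1 w * (?N - 0 / 2)"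
        by (intro tendsto_intros) simp_all
      then show "(\<lambda>n. gaussian 1 w * (?N - D (w /\<^sub>R Suc n) / 2)) \<longlonglongrightarrow> gaussian 1 w * ?N" by simp
    qed
    show "AE w in lborel. norm (gaussian 1 w * (?N - D (w /\<^sub>R Suc n) / 2)) \<le> gaussian 1 w * (3 * ?N)" for n
    proof (rule AE_I2)
      fix w :: 'a
      have "\<bar>?N - D (w /\<^sub>R Suc n) / 2\<bar> \<le> 3 * ?N"
        using D4[of "w /\<^sub>R Suc n"] zero_le_power2[of "L2_norm f"]
        unfolding D_def by (smt (verit) zero_le_power2 field_sum_of_halves)
      then show "norm (gaussian 1 w * (?N - D (w /\<^sub>R Suc n) / 2)) \<le> gaussian 1 w * (3 * ?N)"
        using gaussian_pos[of 1 w] by (simp add: abs_mult mult_left_mono)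
    qed
  qed (use integrable_gaussian[of 1] in auto)
  from tendsto_mult_left[OF this, of "sqrt (2 * pi) ^ DIM('a)"]
  have lim0: "(\<lambda>n. \<integral>\<xi>. (cmod (fourier_integral f \<xi>))\<^sup>2 * gaussian (\<epsilon> n) \<xi> \<partial>lborel)
      \<longlonglongrightarrow> sqrt (2 * pi) ^ DIM('a) * (\<integral>w. gaussian 1 (w::'a) * ?N \<partial>lborel)"
    by (simp only: damped)
  \<comment> \<open>One factor comes from the transform of the Gaussian and one from its total
    mass.\<close>
  moreover have "sqrt (2 * pi) ^ DIM('a) * sqrt (2 * pi) ^ DIM('a) = (2 * pi) ^ DIM('a)"
    by (simp only: power_mult_distrib[symmetric]) simp
  then have "sqrt (2 * pi) ^ DIM('a) * (\<integral>w. gaussian 1 (w::'a) * ?N \<partial>lborel) = (2 * pi) ^ DIM('a) * ?N"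
    using integral_gaussian[of 1, where 'a = 'a] by (simp only: integral_mult_left_zero) simp
  ultimately have lim: "(\<lambda>n. \<integral>\<xi>. (cmod (fourier_integral f \<xi>))\<^sup>2 * gaussian (\<epsilon> n) \<xi> \<partial>lborel)
      \<longlonglongrightarrow> (2 * pi) ^ DIM('a) * ?N"
    by (simp only:)
  have int: "integrable lborel (\<lambda>\<xi>::'a. (cmod (fourier_integral f \<xi>))\<^sup>2 * gaussian (\<epsilon> n) \<xi>)" for n
  proof (rule Bochner_Integration.integrable_bound)
    show "integrable lborel (\<lambda>\<xi>::'a. (L1_norm f)\<^sup>2 * gaussian (\<epsilon> n) \<xi>)"
      by (intro Bochner_Integration.integrable_mult_right integrable_gaussian \<epsilon>)
    show "AE \<xi> in lborel. norm ((cmod (fourier_integral f \<xi>))\<^sup>2 * gaussian (\<epsilon> n) \<xi>) \<le> norm ((L1_norm f)\<^sup>2 * gaussian (\<epsilon> n) \<xi>)"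
      using cmod_fourier_integral_le[OF f(1)] gaussian_pos[of "\<epsilon> n"]
      by (intro AE_I2) (auto simp: abs_mult intro!: mult_right_mono power_mono)
  qed measurable
  have mono: "AE \<xi> in lborel. mono (\<lambda>n. (cmod (fourier_integral f \<xi>))\<^sup>2 * gaussian (\<epsilon> n) \<xi>)"
  proof (intro AE_I2 monoI mult_left_mono)
    fix m n :: nat and \<xi> :: 'a assume "m \<le> n"
    then have "\<epsilon> n \<le> \<epsilon> m" unfolding \<epsilon>_def by (intro divide_left_mono power_mono) auto
    then show "gaussian (\<epsilon> m) \<xi> \<le> gaussian (\<epsilon> n) \<xi>"
      by (simp add: gaussian_def mult_right_mono)
  qed simp
  have pt: "AE \<xi> in lborel. (\<lambda>n. (cmod (fourier_integral f \<xi>))\<^sup>2 * gaussian (\<epsilon> n) \<xi>) \<longlonglongrightarrow> (cmod (fourier_integral f \<xi>))\<^sup>2"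
  proof (rule AE_I2)
    fix \<xi> :: 'a
    have "(\<lambda>n. (inverse (real (Suc n)))\<^sup>2) \<longlonglongrightarrow> 0\<^sup>2"
      by (intro tendsto_intros LIMSEQ_inverse_real_of_nat)
    then have "\<epsilon> \<longlonglongrightarrow> 0" by (simp add: \<epsilon>_def[abs_def] inverse_eq_divide power_divide)
    then have "(\<lambda>n. (cmod (fourier_integral f \<xi>))\<^sup>2 * gaussian (\<epsilon> n) \<xi>)
        \<longlonglongrightarrow> (cmod (fourier_integral f \<xi>))\<^sup>2 * exp (- (0 * (norm \<xi>)\<^sup>2 / 2))"
      unfolding gaussian_def by (intro tendsto_intros) auto
    then show "(\<lambda>n. (cmod (fourier_integral f \<xi>))\<^sup>2 * gaussian (\<epsilon> n) \<xi>) \<longlonglongrightarrow> (cmod (fourier_integral f \<xi>))\<^sup>2"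
      by simp
  qed
  have meas: "(\<lambda>\<xi>. (cmod (fourier_integral f \<xi>))\<^sup>2) \<in> borel_measurable lborel" by measurable
  show "fourier_integral f \<in> L2_space"
    using integrable_monotone_convergence[OF int mono pt lim meas] by (simp add: L2_space_def)
  show "(L2_norm (fourier_integral f))\<^sup>2 = (2 * pi) ^ DIM('a) * (L2_norm f)\<^sup>2"
    using integral_monotone_convergence[OF int mono pt lim meas] by (simp add: L2_norm_power2)
qed

section \<open>The Fourier transform on \<open>L\<^sup>2\<close>\<close>

abbreviation trunc :: "real \<Rightarrow> ('a::euclidean_space \<Rightarrow> complex) \<Rightarrow> 'a \<Rightarrow> complex" where
  "trunc R f \<equiv> \<lambda>x. indicator (cball 0 R) x * f x"

lemma L2_space_trunc: "f \<in> L2_space \<Longrightarrow> trunc R f \<in> L2_space"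
  by (intro L2_space_indicator) auto

text \<open>The indicator of a ball of finite measure is itself square integrable, and a product of
  two such functions is integrable.\<close>

lemma L1_space_trunc:
  assumes "f \<in> L2_space"
  shows "trunc R f \<in> L1_space"
proof -
  have "(indicator (cball 0 R) :: 'a \<Rightarrow> complex) \<in> L2_space"
    by (rule L2_spaceI[where g = "indicator (cball 0 R)"])
       (use emeasure_bounded_finite[of "cball 0 R :: 'a set"] in
         \<open>auto simp: integrable_indicator_iff intro!: borel_measurable_indicator split: split_indicator\<close>)
  then show ?thesis
    unfolding L1_space_def mem_Collect_eq by (rule L2_space_mult_integrable[OF _ assms])
qed

lemma tendsto_L2_trunc:
  assumes f: "f \<in> L2_space"
  shows "((\<lambda>R. L2_norm (\<lambda>x. trunc R f x - f x)) \<longlongrightarrow> 0) at_top"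
proof -
  note [measurable] = L2_space_measurable[OF f]
  have "((\<lambda>R. \<integral>x. (cmod (trunc R f x - f x))\<^sup>2 \<partial>lborel) \<longlongrightarrow> (\<integral>x. 0 \<partial>(lborel :: 'a measure))) at_top"
  proof (rule integral_dominated_convergence_at_top)
    show "integrable lborel (\<lambda>x. (cmod (f x))\<^sup>2)" by (rule L2_spaceD[OF f])
    show "\<forall>\<^sub>F R in at_top. AE x in lborel. norm ((cmod (trunc R f x - f x))\<^sup>2) \<le> (cmod (f x))\<^sup>2"
      by (intro always_eventually allI AE_I2) (auto split: split_indicator)
    show "AE x in lborel. ((\<lambda>R. (cmod (trunc R f x - f x))\<^sup>2) \<longlongrightarrow> 0) at_top"
    proof (rule AE_I2)
      fix x :: 'a
      have "\<forall>\<^sub>F R in at_top. (cmod (trunc R f x - f x))\<^sup>2 = 0"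
        using eventually_ge_at_top[of "norm x"] by eventually_elim simp
      then show "((\<lambda>R. (cmod (trunc R f x - f x))\<^sup>2) \<longlongrightarrow> 0) at_top"
        by (rule tendsto_eventually)
    qed
    show "(\<lambda>x. (cmod (trunc R f x - f x))\<^sup>2) \<in> borel_measurable lborel" for R
      using L2_space_measurable[OF L2_space_diff[OF L2_space_trunc[OF f] f]] by simp
  qed simp
  then have "((\<lambda>R. \<integral>x. (cmod (trunc R f x - f x))\<^sup>2 \<partial>lborel) \<longlongrightarrow> 0) at_top" by simp
  from tendsto_real_sqrt[OF this] show ?thesis by (simp add: L2_norm_def)
qed

text \<open>The ratio of the squared norms, kept as a named constant: the decay estimates use only
  that it is positive.\<close>

definition plancherel_const :: "'a::euclidean_space itself \<Rightarrow> real" where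
  "plancherel_const _ = (2 * pi) ^ DIM('a)"

lemma plancherel_const_pos: "plancherel_const TYPE('a::euclidean_space) > 0"
  by (simp add: plancherel_const_def)

lemma L2_norm_fourier_integral:
  fixes f :: "'a::euclidean_space \<Rightarrow> complex"
  assumes "f \<in> L1_space" "f \<in> L2_space"
  shows "L2_norm (fourier_integral f) = sqrt (plancherel_const TYPE('a)) * L2_norm f"
proof -
  have "sqrt ((L2_norm (fourier_integral f))\<^sup>2) = sqrt (plancherel_const TYPE('a) * (L2_norm f)\<^sup>2)"
    using Plancherel_L1_L2[OF assms] by (simp add: plancherel_const_def)
  then show ?thesis by (simp add: real_sqrt_mult)
qed

lemma L1_space_diff: "f \<in> L1_space \<Longrightarrow> g \<in> L1_space \<Longrightarrow> (\<lambda>x. f x - g x) \<in> L1_space"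
  by (simp add: L1_space_def)

lemma L2_norm_fourier_integral_diff:
  fixes f :: "'a::euclidean_space \<Rightarrow> complex"
  assumes "f \<in> L1_space" "f \<in> L2_space" "g \<in> L1_space" "g \<in> L2_space"
  shows "L2_norm (\<lambda>\<xi>. fourier_integral f \<xi> - fourier_integral g \<xi>)
    = sqrt (plancherel_const TYPE('a)) * L2_norm (\<lambda>x. f x - g x)"
proof -
  have "(\<lambda>\<xi>. fourier_integral f \<xi> - fourier_integral g \<xi>) = fourier_integral (\<lambda>x. f x - g x)"
    by (rule ext) (rule fourier_integral_diff[OF assms(1,3), symmetric])
  then show ?thesis
    using L2_norm_fourier_integral[OF L1_space_diff[OF assms(1,3)] L2_space_diff[OF assms(2,4)]] by simp
qed

lemma L2_space_fourier_trunc: "f \<in> L2_space \<Longrightarrow> fourier_integral (trunc R f) \<in> L2_space"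
  by (intro L2_space_fourier_integral L1_space_trunc L2_space_trunc)

text \<open>Truncated functions lie in both L1 and L2, so their transforms are square integrable and
  the extended integral in the definition is finite. This permits working with
  \<open>L2_norm\<close> from here on.\<close>

lemma is_fourier_iff:
  "is_fourier f g \<longleftrightarrow> f \<in> L2_space \<and> g \<in> L2_space \<and>
    ((\<lambda>R. L2_norm (\<lambda>\<xi>. fourier_integral (trunc R f) \<xi> - g \<xi>)) \<longlongrightarrow> 0) at_top"
proof -
  have "((\<lambda>R. \<integral>\<^sup>+\<xi>. ennreal ((cmod (fourier_integral (trunc R f) \<xi> - g \<xi>))\<^sup>2) \<partial>lborel) \<longlongrightarrow> 0) at_top
      \<longleftrightarrow> ((\<lambda>R. L2_norm (\<lambda>\<xi>. fourier_integral (trunc R f) \<xi> - g \<xi>)) \<longlongrightarrow> 0) at_top"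
    if "f \<in> L2_space" "g \<in> L2_space"
  proof -
    have "(\<integral>\<^sup>+\<xi>. ennreal ((cmod (fourier_integral (trunc R f) \<xi> - g \<xi>))\<^sup>2) \<partial>lborel)
        = ennreal ((L2_norm (\<lambda>\<xi>. fourier_integral (trunc R f) \<xi> - g \<xi>))\<^sup>2)" for R
      using that by (intro nn_integral_L2_space L2_space_diff L2_space_fourier_trunc)
    moreover have "((\<lambda>R. h R ^ 2) \<longlongrightarrow> 0) at_top \<longleftrightarrow> (h \<longlongrightarrow> 0) at_top" for h :: "real \<Rightarrow> real"
      using tendsto_real_sqrt[of "\<lambda>R. (h R)\<^sup>2" 0 at_top] tendsto_power[of h 0 at_top 2]
      by (auto simp: tendsto_rabs_zero_iff)
    ultimately show ?thesis
      by (simp add: tendsto_ennreal_iff flip: ennreal_0)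
  qed
  then show ?thesis unfolding is_fourier_def by blast
qed

lemma is_fourierD:
  assumes "is_fourier f g"
  shows "f \<in> L2_space" "g \<in> L2_space"
    "((\<lambda>R. L2_norm (\<lambda>\<xi>. fourier_integral (trunc R f) \<xi> - g \<xi>)) \<longlongrightarrow> 0) at_top"
  using assms by (auto simp: is_fourier_iff)

text \<open>Both norms are limits along the truncations, for which the identity is already
  known.\<close>

theorem Plancherel:
  fixes f g :: "'a::euclidean_space \<Rightarrow> complex"
  assumes "is_fourier f g"
  shows "L2_norm g = sqrt (plancherel_const TYPE('a)) * L2_norm f"
proof (rule tendsto_unique)
  note f = is_fourierD[OF assms]
  show "((\<lambda>R. L2_norm (fourier_integral (trunc R f))) \<longlongrightarrow> L2_norm g) at_top"
    using f by (intro tendsto_L2_norm L2_space_fourier_trunc)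
  have "((\<lambda>R. sqrt (plancherel_const TYPE('a)) * L2_norm (trunc R f))
      \<longlongrightarrow> sqrt (plancherel_const TYPE('a)) * L2_norm f) at_top"
    using f by (intro tendsto_intros tendsto_L2_norm L2_space_trunc tendsto_L2_trunc)
  then show "((\<lambda>R. L2_norm (fourier_integral (trunc R f))) \<longlongrightarrow> sqrt (plancherel_const TYPE('a)) * L2_norm f) at_top"
    using f by (simp add: L2_norm_fourier_integral L1_space_trunc L2_space_trunc)
qed simp

corollary Plancherel_power2:
  fixes f g :: "'a::euclidean_space \<Rightarrow> complex"
  assumes "is_fourier f g"
  shows "(L2_norm g)\<^sup>2 = plancherel_const TYPE('a) * (L2_norm f)\<^sup>2"
  using Plancherel[OF assms] plancherel_const_pos[where 'a = 'a] by (simp add: power_mult_distrib)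

section \<open>Linearity, uniqueness and existence\<close>

lemma is_fourier_cmult:
  assumes "is_fourier f g"
  shows "is_fourier (\<lambda>x. c * f x) (\<lambda>\<xi>. c * g \<xi>)"
proof -
  note f = is_fourierD[OF assms]
  have "fourier_integral (trunc R (\<lambda>x. c * f x)) \<xi> - c * g \<xi> = c * (fourier_integral (trunc R f) \<xi> - g \<xi>)" for R \<xi>
    using fourier_integral_cmult[of c "trunc R f" \<xi>] by (simp add: right_diff_distrib mult.left_commute)
  moreover have "((\<lambda>R. cmod c * L2_norm (\<lambda>\<xi>. fourier_integral (trunc R f) \<xi> - g \<xi>)) \<longlongrightarrow> cmod c * 0) at_top"
    by (intro tendsto_intros f)
  ultimately show ?thesis
    using f by (simp add: is_fourier_iff L2_space_cmult L2_norm_cmult)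
qed

lemma is_fourier_add:
  assumes "is_fourier f1 g1" "is_fourier f2 g2"
  shows "is_fourier (\<lambda>x. f1 x + f2 x) (\<lambda>\<xi>. g1 \<xi> + g2 \<xi>)"
proof -
  note f1 = is_fourierD[OF assms(1)] and f2 = is_fourierD[OF assms(2)]
  have eq: "fourier_integral (trunc R (\<lambda>x. f1 x + f2 x)) \<xi> - (g1 \<xi> + g2 \<xi>)
      = (fourier_integral (trunc R f1) \<xi> - g1 \<xi>) + (fourier_integral (trunc R f2) \<xi> - g2 \<xi>)" for R \<xi>
    using fourier_integral_add[OF L1_space_trunc[OF f1(1)] L1_space_trunc[OF f2(1)], of R R \<xi>]
    by (simp add: distrib_left)
  have "((\<lambda>R. L2_norm (\<lambda>\<xi>. fourier_integral (trunc R (\<lambda>x. f1 x + f2 x)) \<xi> - (g1 \<xi> + g2 \<xi>))) \<longlongrightarrow> 0) at_top"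
  proof (rule Lim_null_comparison[OF always_eventually[OF allI]])
    show "((\<lambda>R. L2_norm (\<lambda>\<xi>. fourier_integral (trunc R f1) \<xi> - g1 \<xi>)
        + L2_norm (\<lambda>\<xi>. fourier_integral (trunc R f2) \<xi> - g2 \<xi>)) \<longlongrightarrow> 0) at_top"
      using tendsto_add[OF f1(3) f2(3)] by simp
    show "norm (L2_norm (\<lambda>\<xi>. fourier_integral (trunc R (\<lambda>x. f1 x + f2 x)) \<xi> - (g1 \<xi> + g2 \<xi>)))
        \<le> L2_norm (\<lambda>\<xi>. fourier_integral (trunc R f1) \<xi> - g1 \<xi>)
        + L2_norm (\<lambda>\<xi>. fourier_integral (trunc R f2) \<xi> - g2 \<xi>)" for R
      unfolding eq using f1 f2
      by (simp add: L2_norm_triangle L2_space_diff L2_space_fourier_trunc)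
  qed
  then show ?thesis using f1 f2 by (simp add: is_fourier_iff L2_space_add)
qed

lemma is_fourier_diff:
  assumes "is_fourier f1 g1" "is_fourier f2 g2"
  shows "is_fourier (\<lambda>x. f1 x - f2 x) (\<lambda>\<xi>. g1 \<xi> - g2 \<xi>)"
  using is_fourier_add[OF assms(1) is_fourier_cmult[OF assms(2), of "-1"]] by simp

text \<open>By linearity the difference of the two is a transform of the zero function, hence has
  norm 0.\<close>

lemma is_fourier_unique:
  fixes f :: "'a::euclidean_space \<Rightarrow> complex"
  assumes "is_fourier f g1" "is_fourier f g2"
  shows "AE \<xi> in lborel. g1 \<xi> = g2 \<xi>"
proof -
  have "L2_norm (\<lambda>\<xi>. g1 \<xi> - g2 \<xi>) = 0"
    using Plancherel[OF is_fourier_diff[OF assms]] by (simp add: L2_norm_def)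
  then show ?thesis
    using L2_norm_eq_0_iff_AE[OF L2_space_diff[OF is_fourierD(2)[OF assms(1)] is_fourierD(2)[OF assms(2)]]]
    by simp
qed

lemma is_fourier_fourier_integral:
  fixes f :: "'a::euclidean_space \<Rightarrow> complex"
  assumes f: "f \<in> L1_space" "f \<in> L2_space"
  shows "is_fourier f (fourier_integral f)"
proof -
  have "((\<lambda>R. sqrt (plancherel_const TYPE('a)) * L2_norm (\<lambda>x. trunc R f x - f x))
      \<longlongrightarrow> sqrt (plancherel_const TYPE('a)) * 0) at_top"
    by (intro tendsto_intros tendsto_L2_trunc f)
  then show ?thesis
    using f by (simp add: is_fourier_iff L2_space_fourier_integral L2_norm_fourier_integral_diff
      L1_space_trunc L2_space_trunc)
qed

text \<open>Plancherel for truncations turns their convergence in L2 into a Cauchy condition on the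
  transforms.\<close>

lemma is_fourier_exists:
  fixes f :: "'a::euclidean_space \<Rightarrow> complex"
  assumes f: "f \<in> L2_space"
  shows "\<exists>g. is_fourier f g"
proof -
  let ?F = "\<lambda>R. fourier_integral (trunc R f)"
  define s where "s = sqrt (plancherel_const TYPE('a))"
  have s: "s > 0" using plancherel_const_pos[where 'a = 'a] by (simp add: s_def)
  have diff: "L2_norm (\<lambda>\<xi>. ?F R \<xi> - ?F R' \<xi>) \<le> s * (L2_norm (\<lambda>x. trunc R f x - f x) + L2_norm (\<lambda>x. trunc R' f x - f x))" for R R'
  proof -
    have "L2_norm (\<lambda>\<xi>. ?F R \<xi> - ?F R' \<xi>) = s * L2_norm (\<lambda>x. trunc R f x - trunc R' f x)"
      unfolding s_def using f by (intro L2_norm_fourier_integral_diff L1_space_trunc L2_space_trunc)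
    also have "\<dots> \<le> s * (L2_norm (\<lambda>x. trunc R f x - f x) + L2_norm (\<lambda>x. f x - trunc R' f x))"
      using f s by (intro mult_left_mono L2_norm_diff_triangle L2_space_trunc) auto
    finally show ?thesis by (simp add: L2_norm_minus_commute[of f])
  qed
  have small: "\<exists>R0. \<forall>R\<ge>R0. \<forall>R'\<ge>R0. L2_norm (\<lambda>\<xi>. ?F R \<xi> - ?F R' \<xi>) < e" if "e > 0" for e
  proof -
    have "\<forall>\<^sub>F R in at_top. L2_norm (\<lambda>x. trunc R f x - f x) < e / (2 * s)"
      using order_tendstoD(2)[OF tendsto_L2_trunc[OF f]] that s by simp
    then obtain R0 where R0: "\<And>R. R \<ge> R0 \<Longrightarrow> L2_norm (\<lambda>x. trunc R f x - f x) < e / (2 * s)"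
      by (auto simp: eventually_at_top_linorder)
    have "L2_norm (\<lambda>\<xi>. ?F R \<xi> - ?F R' \<xi>) < e" if "R \<ge> R0" "R' \<ge> R0" for R R'
    proof -
      have "s * (L2_norm (\<lambda>x. trunc R f x - f x) + L2_norm (\<lambda>x. trunc R' f x - f x)) < s * (e / (2 * s) + e / (2 * s))"
        using s R0 that by (intro mult_strict_left_mono add_strict_mono)
      also have "\<dots> = e" using s by (simp add: field_simps)
      finally show ?thesis using diff[of R R'] by simp
    qed
    then show ?thesis by blast
  qed
  \<comment> \<open>Completeness concerns sequences, so the limit is first taken along integer
    radii.\<close>
  have "\<exists>g\<in>L2_space. (\<lambda>n. L2_norm (\<lambda>\<xi>. ?F (real n) \<xi> - g \<xi>)) \<longlonglongrightarrow> 0"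
  proof (rule L2_complete)
    fix e :: real assume "e > 0"
    then obtain R0 where "\<forall>R\<ge>R0. \<forall>R'\<ge>R0. L2_norm (\<lambda>\<xi>. ?F R \<xi> - ?F R' \<xi>) < e"
      using small by blast
    then show "\<exists>N. \<forall>m\<ge>N. \<forall>n\<ge>N. L2_norm (\<lambda>\<xi>. ?F (real m) \<xi> - ?F (real n) \<xi>) < e"
      by (intro exI[of _ "nat \<lceil>R0\<rceil>"]) (auto simp: nat_ceiling_le_eq)
  qed (intro L2_space_fourier_trunc f)
  then obtain g where g: "g \<in> L2_space" "(\<lambda>n. L2_norm (\<lambda>\<xi>. ?F (real n) \<xi> - g \<xi>)) \<longlonglongrightarrow> 0" by blast
  \<comment> \<open>The Cauchy condition holds for all real radii; comparison with one large integer
    radius extends the limit to \<open>at_top\<close>.\<close>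
  have "((\<lambda>R. L2_norm (\<lambda>\<xi>. ?F R \<xi> - g \<xi>)) \<longlongrightarrow> 0) at_top"
  proof (rule tendstoI)
    fix e :: real assume "e > 0"
    then obtain R0 where R0: "\<forall>R\<ge>R0. \<forall>R'\<ge>R0. L2_norm (\<lambda>\<xi>. ?F R \<xi> - ?F R' \<xi>) < e / 2"
      using small[of "e / 2"] by auto
    have "\<forall>\<^sub>F n in sequentially. L2_norm (\<lambda>\<xi>. ?F (real n) \<xi> - g \<xi>) < e / 2 \<and> real n \<ge> R0"
    proof (rule eventually_conj)
      show "\<forall>\<^sub>F n in sequentially. L2_norm (\<lambda>\<xi>. ?F (real n) \<xi> - g \<xi>) < e / 2"
        using order_tendstoD(2)[OF g(2), of "e / 2"] \<open>e > 0\<close> by simp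
      show "\<forall>\<^sub>F n in sequentially. real n \<ge> R0"
        using eventually_ge_at_top[of "nat \<lceil>R0\<rceil>"] by (simp only: nat_ceiling_le_eq)
    qed
    then obtain n where n: "L2_norm (\<lambda>\<xi>. ?F (real n) \<xi> - g \<xi>) < e / 2" "real n \<ge> R0"
      using eventually_happens'[OF sequentially_bot] by blast
    have "L2_norm (\<lambda>\<xi>. ?F R \<xi> - g \<xi>) < e" if "R \<ge> R0" for R
    proof -
      have "L2_norm (\<lambda>\<xi>. ?F R \<xi> - g \<xi>) \<le> L2_norm (\<lambda>\<xi>. ?F R \<xi> - ?F (real n) \<xi>) + L2_norm (\<lambda>\<xi>. ?F (real n) \<xi> - g \<xi>)"
        by (intro L2_norm_diff_triangle L2_space_fourier_trunc f g)
      moreover have "L2_norm (\<lambda>\<xi>. ?F R \<xi> - ?F (real n) \<xi>) < e / 2" using R0 n that by blast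
      ultimately show ?thesis using n by linarith
    qed
    then show "\<forall>\<^sub>F R in at_top. dist (L2_norm (\<lambda>\<xi>. ?F R \<xi> - g \<xi>)) 0 < e"
      by (auto simp: eventually_at_top_linorder)
  qed
  then show ?thesis using f g(1) by (auto simp: is_fourier_iff)
qed

section \<open>Symmetry and surjectivity\<close>

lemma integral_is_fourier_mult:
  assumes "is_fourier f F" "is_fourier h H"
  shows "(\<integral>\<xi>. F \<xi> * h \<xi> \<partial>lborel) = (\<integral>x. f x * H x \<partial>lborel)"
proof (rule tendsto_unique)
  note f = is_fourierD[OF assms(1)] and h = is_fourierD[OF assms(2)]
  show "((\<lambda>R. \<integral>\<xi>. fourier_integral (trunc R f) \<xi> * trunc R h \<xi> \<partial>lborel) \<longlongrightarrow> (\<integral>\<xi>. F \<xi> * h \<xi> \<partial>lborel)) at_top"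
    using f h by (intro tendsto_L2_inner L2_space_fourier_trunc L2_space_trunc tendsto_L2_trunc)
  have "((\<lambda>R. \<integral>x. trunc R f x * fourier_integral (trunc R h) x \<partial>lborel) \<longlongrightarrow> (\<integral>x. f x * H x \<partial>lborel)) at_top"
    using f h by (intro tendsto_L2_inner L2_space_fourier_trunc L2_space_trunc tendsto_L2_trunc)
  then show "((\<lambda>R. \<integral>\<xi>. fourier_integral (trunc R f) \<xi> * trunc R h \<xi> \<partial>lborel) \<longlongrightarrow> (\<integral>x. f x * H x \<partial>lborel)) at_top"
    using f h by (simp only: integral_fourier_integral_mult L1_space_trunc)
qed simp

text \<open>
  The adjoint of the Fourier transform is \<open>g \<mapsto> cnj (F (cnj g))\<close>, which is an isometry up to a
  constant as well. Expanding the square of \<open>F (F\<^sup>* g) / c - g\<close> then shows that it vanishes.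
\<close>

theorem is_fourier_surj:
  fixes g :: "'a::euclidean_space \<Rightarrow> complex"
  assumes g: "g \<in> L2_space"
  shows "\<exists>f. is_fourier f g"
proof -
  define c where "c = plancherel_const TYPE('a)"
  have c: "c > 0" unfolding c_def by (rule plancherel_const_pos)
  obtain H where H: "is_fourier (\<lambda>x. cnj (g x)) H"
    using is_fourier_exists[OF L2_space_cnj[OF g]] by blast
  note H2 = is_fourierD(2)[OF H]
  \<comment> \<open>The candidate preimage is the adjoint applied to \<open>g\<close>, divided by
    the Plancherel constant.\<close>
  define f where "f x = complex_of_real (1 / c) * cnj (H x)" for x
  have f: "f \<in> L2_space" unfolding f_def by (intro L2_space_cmult L2_space_cnj H2)
  obtain F where F: "is_fourier f F" using is_fourier_exists[OF f] by blast
  note F2 = is_fourierD(2)[OF F]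
  have HN: "(L2_norm H)\<^sup>2 = c * (L2_norm g)\<^sup>2"
    using Plancherel_power2[OF H] by (simp add: L2_norm_cnj c_def)
  \<comment> \<open>Symmetry of the transform makes the inner product of \<open>F\<close> and
    \<open>g\<close> equal to the squared norm of \<open>H\<close> over \<open>c\<close>, thus to
    that of \<open>g\<close>. As \<open>F\<close> has the same norm as \<open>g\<close>, equality
    holds in Cauchy-Schwarz and the two coincide.\<close>
  have "(\<integral>\<xi>. F \<xi> * cnj (g \<xi>) \<partial>lborel) = (\<integral>x. f x * H x \<partial>lborel)"
    by (rule integral_is_fourier_mult[OF F H])
  also have "\<dots> = (\<integral>x. complex_of_real ((1 / c) * (cmod (H x))\<^sup>2) \<partial>lborel)"
    by (intro Bochner_Integration.integral_cong refl)
       (simp only: f_def of_real_mult complex_norm_square mult_ac)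
  also have "\<dots> = complex_of_real ((1 / c) * (L2_norm H)\<^sup>2)"
    by (simp only: integral_complex_of_real L2_norm_power2 integral_mult_right_zero)
  finally have inner: "Re (\<integral>\<xi>. F \<xi> * cnj (g \<xi>) \<partial>lborel) = (L2_norm g)\<^sup>2"
    using c by (simp add: HN)
  have "f = (\<lambda>x. complex_of_real (1 / c) * cnj (H x))" by (simp add: f_def fun_eq_iff)
  then have "L2_norm f = cmod (complex_of_real (1 / c)) * L2_norm H"
    by (simp only: L2_norm_cmult L2_norm_cnj)
  then have "L2_norm f = L2_norm H / c" using c by (simp add: norm_divide)
  then have FN: "(L2_norm F)\<^sup>2 = (L2_norm g)\<^sup>2"
    using Plancherel_power2[OF F] c HN by (simp add: power_divide power2_eq_square[of c] c_def[symmetric])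
  have "(L2_norm (\<lambda>\<xi>. F \<xi> - g \<xi>))\<^sup>2 = 0"
    using L2_norm_diff_power2[OF F2 g] inner FN by simp
  then have "AE \<xi> in lborel. F \<xi> = g \<xi>"
    using L2_norm_eq_0_iff_AE[OF L2_space_diff[OF F2 g]] by simp
  then have "L2_norm (\<lambda>\<xi>. fourier_integral (trunc R f) \<xi> - F \<xi>) = L2_norm (\<lambda>\<xi>. fourier_integral (trunc R f) \<xi> - g \<xi>)" for R
    using f by (intro L2_norm_cong_AE L2_space_measurable L2_space_diff L2_space_fourier_trunc F2 g) auto
  then have "is_fourier f g"
    using is_fourierD(3)[OF F] f g by (simp add: is_fourier_iff)
  then show ?thesis by blast
qed

section \<open>The chosen representatives\<close>

lemma is_fourier_fourier: "f \<in> L2_space \<Longrightarrow> is_fourier f (fourier f)"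
  unfolding fourier_def by (rule someI_ex[OF is_fourier_exists])

lemma is_fourier_inv_fourier: "g \<in> L2_space \<Longrightarrow> is_fourier (inv_fourier g) g"
  unfolding inv_fourier_def by (rule someI_ex[OF is_fourier_surj])

lemma L2_space_fourier: "f \<in> L2_space \<Longrightarrow> fourier f \<in> L2_space"
  using is_fourierD(2)[OF is_fourier_fourier] .

text \<open>The chosen representative agrees with the Fourier integral only almost everywhere, and
  the bound is inherited from the latter.\<close>

lemma AE_cmod_fourier_le:
  fixes f :: "'a::euclidean_space \<Rightarrow> complex"
  assumes "f \<in> L1_space" "f \<in> L2_space"
  shows "AE \<xi> in lborel. cmod (fourier f \<xi>) \<le> L1_norm f"
  using is_fourier_unique[OF is_fourier_fourier[OF assms(2)] is_fourier_fourier_integral[OF assms]]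
  by eventually_elim (simp add: cmod_fourier_integral_le assms)

section \<open>Decay at a single frequency\<close>

text \<open>With the integrating factor \<open>exp (k * t)\<close> the function is nonincreasing.
  Two-sided derivatives are used only at interior times; at 0 continuity suffices.\<close>

lemma exp_decay_of_derivative_le:
  fixes F :: "real \<Rightarrow> real"
  assumes F: "\<And>t. t \<ge> 0 \<Longrightarrow> (F has_real_derivative F' t) (at t within {0..})"
    and le: "\<And>t. t \<ge> 0 \<Longrightarrow> F' t \<le> - k * F t" and t: "t \<ge> 0"
  shows "F t \<le> exp (- (k * t)) * F 0"
proof -
  have d: "((\<lambda>t. exp (k * t) * F t) has_real_derivative exp (k * t) * (k * F t + F' t)) (at t within {0..})"
    if "t \<ge> 0" for t
    by (rule derivative_eq_intros F that refl | simp add: algebra_simps)+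
  have "exp (k * t) * F t \<le> exp (k * 0) * F 0"
  proof (rule DERIV_nonpos_imp_decreasing_open[OF t])
    fix x assume x: "0 < x" "x < t"
    have "at x within {0..} = at x" using x by (intro at_within_interior) simp
    then have "((\<lambda>t. exp (k * t) * F t) has_real_derivative exp (k * x) * (k * F x + F' x)) (at x)"
      using d[of x] x by simp
    moreover have "exp (k * x) * (k * F x + F' x) \<le> 0"
      using le[of x] x by (intro mult_nonneg_nonpos) auto
    ultimately show "\<exists>y. ((\<lambda>t. exp (k * t) * F t) has_real_derivative y) (at x) \<and> y \<le> 0" by blast
  next
    have "continuous_on {0..} (\<lambda>t. exp (k * t) * F t)"
      using d by (intro DERIV_continuous_on) auto
    then show "continuous_on {0..t} (\<lambda>t. exp (k * t) * F t)" by (rule continuous_on_subset) auto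
  qed
  then show ?thesis by (simp add: exp_minus field_simps)
qed

text \<open>Real-valued, because the coefficient is real: the real and imaginary parts of a complex
  solution solve the equation separately, and their energies add up to that of the solution.\<close>

locale damped_oscillator =
  fixes a :: real and p q :: "real \<Rightarrow> real"
  assumes a_nonneg: "a \<ge> 0"
    and p: "\<And>t. t \<ge> 0 \<Longrightarrow> (p has_real_derivative q t) (at t within {0..})"
    and q: "\<And>t. t \<ge> 0 \<Longrightarrow> (q has_real_derivative - a * p t - a * q t) (at t within {0..})"
begin

definition E :: "real \<Rightarrow> real" where "E t = (q t)\<^sup>2 + a * (p t)\<^sup>2"

text \<open>
  The added cross term \<open>2 \<delta> p q\<close> produces the missing dissipation of \<open>p\<close>, and \<open>\<delta> a p\<^sup>2\<close> cancels the
  mixed term of its derivative.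
\<close>

definition F :: "real \<Rightarrow> real \<Rightarrow> real" where
  "F \<delta> t = (q t)\<^sup>2 + a * (p t)\<^sup>2 + 2 * \<delta> * (p t * q t) + \<delta> * a * (p t)\<^sup>2"

lemma F_derivative:
  "t \<ge> 0 \<Longrightarrow> (F \<delta> has_real_derivative - 2 * (a - \<delta>) * (q t)\<^sup>2 - 2 * \<delta> * (a * (p t)\<^sup>2)) (at t within {0..})"
  unfolding F_def[abs_def]
  by (rule derivative_eq_intros p q refl | assumption | simp add: algebra_simps power2_eq_square)+

text \<open>The choice \<open>\<delta> = a / 2\<close> gives both terms of the derivative the same
  coefficient, so it equals \<open>- a * E t\<close>. For \<open>a \<le> 1\<close> the functional
  lies between \<open>E / 2\<close> and \<open>2 * E\<close>, which yields the rate
  \<open>a / 2\<close> and the constant \<open>2 * 2\<close>.\<close>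

lemma E_decay_low:
  assumes a: "a \<le> 1" and t: "t \<ge> 0"
  shows "E t \<le> 4 * exp (- (a * t / 2)) * E 0"
proof -
  have cross: "\<bar>2 * (a / 2) * (p t * q t)\<bar> \<le> E t / 2" for t
  proof -
    have "2 * (a * \<bar>p t\<bar>) * \<bar>q t\<bar> \<le> (a * \<bar>p t\<bar>)\<^sup>2 + \<bar>q t\<bar>\<^sup>2" by (rule sum_squares_bound)
    moreover have "a * (a * (p t)\<^sup>2) \<le> 1 * (a * (p t)\<^sup>2)"
      using a a_nonneg by (intro mult_right_mono) auto
    ultimately show ?thesis
      using a_nonneg by (simp add: E_def abs_mult power_mult_distrib power2_eq_square[of a] mult.assoc)
  qed
  have upper: "F (a / 2) t \<le> 2 * E t" and lower: "E t / 2 \<le> F (a / 2) t" for t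
  proof -
    have "a / 2 * (a * (p t)\<^sup>2) \<le> 1 / 2 * (a * (p t)\<^sup>2)"
      using a a_nonneg by (intro mult_right_mono) auto
    moreover have "0 \<le> a / 2 * (a * (p t)\<^sup>2)" using a_nonneg by simp
    moreover have "0 \<le> (q t)\<^sup>2" by simp
    moreover have "F (a / 2) t = E t + 2 * (a / 2) * (p t * q t) + a / 2 * (a * (p t)\<^sup>2)"
      by (simp add: F_def E_def)
    moreover have "E t = (q t)\<^sup>2 + a * (p t)\<^sup>2" by (rule E_def)
    ultimately show "F (a / 2) t \<le> 2 * E t" "E t / 2 \<le> F (a / 2) t"
      using abs_le_D1[OF cross[of t]] abs_le_D2[OF cross[of t]] by linarith+
  qed
  have "F (a / 2) t \<le> exp (- (a / 2 * t)) * F (a / 2) 0"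
  proof (rule exp_decay_of_derivative_le[OF F_derivative _ t])
    fix t :: real assume "t \<ge> 0"
    have "- 2 * (a - a / 2) * (q t)\<^sup>2 - 2 * (a / 2) * (a * (p t)\<^sup>2) = - (a / 2) * (2 * E t)"
      by (simp add: E_def algebra_simps)
    also have "\<dots> \<le> - (a / 2) * F (a / 2) t"
      using upper[of t] a_nonneg by (intro mult_left_mono_neg) auto
    finally show "- 2 * (a - a / 2) * (q t)\<^sup>2 - 2 * (a / 2) * (a * (p t)\<^sup>2) \<le> - (a / 2) * F (a / 2) t" .
  qed
  also have "\<dots> \<le> exp (- (a / 2 * t)) * (2 * E 0)"
    by (intro mult_left_mono upper) auto
  finally show ?thesis using lower[of t] by (simp add: mult.commute mult.left_commute)
qed

text \<open>
  \<open>16 / 25\<close> is a square below \<open>ln 2\<close>, and \<open>\<delta> = 1 / 4\<close> gives a rate larger than the \<open>1 / 4\<close> of the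
  theorem, which absorbs the constant \<open>3\<close> for large times.
\<close>

lemma E_decay_high:
  assumes a: "a \<ge> 16 / 25" and t: "t \<ge> 0"
  shows "E t \<le> 3 * exp (- (3 * t / 10)) * E 0"
proof -
  have cross: "\<bar>2 * (1 / 4) * (p t * q t)\<bar> \<le> 5 / 16 * E t" for t
  proof -
    \<comment> \<open>The weight \<open>4 / 5\<close> is the root of \<open>16 / 25\<close>, so the
      square on the right is at most \<open>a * (p t)\<^sup>2\<close>.\<close>
    have "2 * (4 / 5 * \<bar>p t\<bar>) * \<bar>q t\<bar> \<le> (4 / 5 * \<bar>p t\<bar>)\<^sup>2 + \<bar>q t\<bar>\<^sup>2" by (rule sum_squares_bound)
    moreover have "16 / 25 * (p t)\<^sup>2 \<le> a * (p t)\<^sup>2"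
      using a by (intro mult_right_mono) auto
    ultimately show ?thesis
      by (simp add: E_def abs_mult power_mult_distrib power_divide)
  qed
  \<comment> \<open>Here \<open>25 / 16\<close> is \<open>1 + 5 / 16 + 1 / 4\<close> and
    \<open>11 / 16\<close> is \<open>1 - 5 / 16\<close>. Their quotient \<open>25 / 11\<close> is
    below the constant 3.\<close>
  have upper: "F (1 / 4) t \<le> 25 / 16 * E t" and lower: "11 / 16 * E t \<le> F (1 / 4) t" for t
  proof -
    have "0 \<le> a * (p t)\<^sup>2" "0 \<le> (q t)\<^sup>2" using a_nonneg by auto
    moreover have "F (1 / 4) t = E t + 2 * (1 / 4) * (p t * q t) + 1 / 4 * (a * (p t)\<^sup>2)"
      by (simp add: F_def E_def)
    moreover have "E t = (q t)\<^sup>2 + a * (p t)\<^sup>2" by (rule E_def)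
    ultimately show "F (1 / 4) t \<le> 25 / 16 * E t" "11 / 16 * E t \<le> F (1 / 4) t"
      using abs_le_D1[OF cross[of t]] abs_le_D2[OF cross[of t]] by linarith+
  qed
  have E0: "E t \<ge> 0" for t using a_nonneg by (simp add: E_def)
  have "F (1 / 4) t \<le> exp (- (3 / 10 * t)) * F (1 / 4) 0"
  proof (rule exp_decay_of_derivative_le[OF F_derivative _ t])
    fix t :: real assume "t \<ge> 0"
    \<comment> \<open>The dissipation has coefficients at least \<open>39 / 50\<close> on
      \<open>(q t)\<^sup>2\<close> and exactly \<open>1 / 2\<close> on
      \<open>a * (p t)\<^sup>2\<close>; both exceed
      \<open>3 / 10 * 25 / 16 = 15 / 32\<close>.\<close>
    have "16 / 25 * (q t)\<^sup>2 \<le> a * (q t)\<^sup>2" using a by (intro mult_right_mono) auto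
    moreover have "0 \<le> a * (p t)\<^sup>2" "0 \<le> (q t)\<^sup>2" using a_nonneg by auto
    moreover have "- 2 * (a - 1 / 4) * (q t)\<^sup>2 - 2 * (1 / 4) * (a * (p t)\<^sup>2)
        = - 2 * (a * (q t)\<^sup>2) + (q t)\<^sup>2 / 2 - a * (p t)\<^sup>2 / 2"
      by (simp add: algebra_simps)
    moreover have "E t = (q t)\<^sup>2 + a * (p t)\<^sup>2" by (rule E_def)
    ultimately show "- 2 * (a - 1 / 4) * (q t)\<^sup>2 - 2 * (1 / 4) * (a * (p t)\<^sup>2) \<le> - (3 / 10) * F (1 / 4) t"
      using upper[of t] by linarith
  qed
  also have "\<dots> \<le> exp (- (3 / 10 * t)) * (25 / 16 * E 0)"
    by (intro mult_left_mono upper) auto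
  finally have "E t \<le> 25 / 11 * (exp (- (3 / 10 * t)) * E 0)" using lower[of t] by simp
  also have "\<dots> \<le> 3 * (exp (- (3 / 10 * t)) * E 0)"
    using E0 by (intro mult_right_mono) auto
  finally show ?thesis by (simp add: mult.assoc)
qed

end

lemma solves_odeE:
  assumes "solves_ode a y0 y1 y" and a: "a \<ge> 0"
  obtains y' where "\<And>t. t \<ge> 0 \<Longrightarrow> (y has_vector_derivative y' t) (at t within {0..})"
    and "y 0 = y0" "y' 0 = y1"
    and "\<And>t. a \<le> 1 \<Longrightarrow> t \<ge> 0 \<Longrightarrow> (cmod (y' t))\<^sup>2 + a * (cmod (y t))\<^sup>2
      \<le> 4 * exp (- (a * t / 2)) * ((cmod y1)\<^sup>2 + a * (cmod y0)\<^sup>2)"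
    and "\<And>t. a \<ge> 16 / 25 \<Longrightarrow> t \<ge> 0 \<Longrightarrow> (cmod (y' t))\<^sup>2 + a * (cmod (y t))\<^sup>2
      \<le> 3 * exp (- (3 * t / 10)) * ((cmod y1)\<^sup>2 + a * (cmod y0)\<^sup>2)"
proof -
  obtain y' y'' where
    d: "\<And>t. t \<ge> 0 \<Longrightarrow> (y has_vector_derivative y' t) (at t within {0..})"
       "\<And>t. t \<ge> 0 \<Longrightarrow> (y' has_vector_derivative y'' t) (at t within {0..})"
    and eq: "\<And>t. t \<ge> 0 \<Longrightarrow> y'' t + complex_of_real a * y t + complex_of_real a * y' t = 0"
    and init: "y 0 = y0" "y' 0 = y1"
    using assms(1) unfolding solves_ode_def by blast
  have y'': "y'' t = - complex_of_real a * y t - complex_of_real a * y' t" if "t \<ge> 0" for t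
    using eq[OF that] by (simp add: algebra_simps eq_neg_iff_add_eq_0)
  interpret re: damped_oscillator a "\<lambda>t. Re (y t)" "\<lambda>t. Re (y' t)"
    using a d y'' by unfold_locales (auto simp: has_vector_derivative_complex_iff)
  interpret im: damped_oscillator a "\<lambda>t. Im (y t)" "\<lambda>t. Im (y' t)"
    using a d y'' by unfold_locales (auto simp: has_vector_derivative_complex_iff)
  have split: "(cmod (y' t))\<^sup>2 + a * (cmod (y t))\<^sup>2 = re.E t + im.E t" for t
    by (simp add: re.E_def im.E_def cmod_power2 algebra_simps)
  have split0: "(cmod y1)\<^sup>2 + a * (cmod y0)\<^sup>2 = re.E 0 + im.E 0"
    using split[of 0] init by simp
  show thesis
  proof (rule that[OF d(1) init])
    show "(cmod (y' t))\<^sup>2 + a * (cmod (y t))\<^sup>2 \<le> 4 * exp (- (a * t / 2)) * ((cmod y1)\<^sup>2 + a * (cmod y0)\<^sup>2)"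
      if "a \<le> 1" "t \<ge> 0" for t
      using re.E_decay_low[OF that] im.E_decay_low[OF that] unfolding split split0 by (simp add: distrib_left)
    show "(cmod (y' t))\<^sup>2 + a * (cmod (y t))\<^sup>2 \<le> 3 * exp (- (3 * t / 10)) * ((cmod y1)\<^sup>2 + a * (cmod y0)\<^sup>2)"
      if "a \<ge> 16 / 25" "t \<ge> 0" for t
      using re.E_decay_high[OF that] im.E_decay_high[OF that] unfolding split split0 by (simp add: distrib_left)
  qed
qed

section \<open>Bounds on the symbol and the estimate at one frequency\<close>

lemma L_symbol_nonneg: "L_symbol \<xi> \<ge> 0"
  by (simp add: L_symbol_def)

lemma L_symbol_le: "L_symbol \<xi> \<le> (norm \<xi>)\<^sup>2"
  unfolding L_symbol_def by (rule ln_add_one_self_le_self) simp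

text \<open>This is \<open>exp (x / 2) \<le> 1 + x\<close> on the unit interval, with
  \<open>x\<close> the squared norm.\<close>

lemma L_symbol_ge:
  assumes "norm \<xi> \<le> 1"
  shows "(norm \<xi>)\<^sup>2 / 2 \<le> L_symbol \<xi>"
proof -
  define x where "x = (norm \<xi>)\<^sup>2"
  have x: "0 \<le> x" "x \<le> 1" using assms power_le_one[of "norm \<xi>" 2] by (auto simp: x_def)
  have "exp (x / 2) \<le> 1 + x / 2 + (x / 2)\<^sup>2" using x by (intro exp_bound) auto
  also have "(x / 2)\<^sup>2 \<le> x / 2"
    using x mult_left_mono[of "x / 2" 1 "x / 2"] by (simp add: power2_eq_square)
  finally have "exp (x / 2) \<le> 1 + x" by simp
  then have "ln (exp (x / 2)) \<le> ln (1 + x)" using x by (subst ln_le_cancel_iff) auto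
  then show ?thesis unfolding L_symbol_def x_def[symmetric] by simp
qed

lemma L_symbol_ge_high:
  assumes "norm \<xi> \<ge> 1"
  shows "L_symbol \<xi> \<ge> 16 / 25"
proof -
  have "(norm \<xi>)\<^sup>2 \<ge> 1" using assms by simp
  then have "ln 2 \<le> L_symbol \<xi>" unfolding L_symbol_def by simp
  then show ?thesis using ln2_ge_two_thirds by simp
qed

lemma borel_measurable_L_symbol [measurable]: "L_symbol \<in> borel_measurable borel"
  unfolding L_symbol_def[abs_def] by measurable

text \<open>The low and high frequency bounds are added, so that one inequality holds at every
  frequency and can be integrated over the whole space. The bounds \<open>M0\<close> and
  \<open>M1\<close> enter only the Gaussian terms; the last term keeps the actual data so that it
  integrates to the initial energy.\<close>

lemma solves_ode_pointwise_decay: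
  fixes \<xi> :: "'a::euclidean_space"
  assumes y: "solves_ode (L_symbol \<xi>) y0 y1 y" and t: "t > 0" and M: "cmod y0 \<le> M0" "cmod y1 \<le> M1"
  shows "\<exists>y'. (y has_vector_derivative y') (at t within {0..}) \<and>
    (cmod y')\<^sup>2 + L_symbol \<xi> * (cmod (y t))\<^sup>2
      \<le> 4 * M1\<^sup>2 * gaussian (t / 2) \<xi> + 32 / t * M0\<^sup>2 * gaussian (t / 4) \<xi>
        + 3 * exp (- (3 * t / 10)) * ((cmod y1)\<^sup>2 + L_symbol \<xi> * (cmod y0)\<^sup>2)"
proof -
  let ?a = "L_symbol \<xi>" and ?r = "(norm \<xi>)\<^sup>2"
  let ?rhs = "4 * M1\<^sup>2 * gaussian (t / 2) \<xi> + 32 / t * M0\<^sup>2 * gaussian (t / 4) \<xi>"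
  let ?rest = "3 * exp (- (3 * t / 10)) * ((cmod y1)\<^sup>2 + ?a * (cmod y0)\<^sup>2)"
  obtain y' where y': "\<And>t. t \<ge> 0 \<Longrightarrow> (y has_vector_derivative y' t) (at t within {0..})"
    and low: "?a \<le> 1 \<Longrightarrow> (cmod (y' t))\<^sup>2 + ?a * (cmod (y t))\<^sup>2
      \<le> 4 * exp (- (?a * t / 2)) * ((cmod y1)\<^sup>2 + ?a * (cmod y0)\<^sup>2)"
    and high: "?a \<ge> 16 / 25 \<Longrightarrow> (cmod (y' t))\<^sup>2 + ?a * (cmod (y t))\<^sup>2 \<le> ?rest"
    using solves_odeE[OF y L_symbol_nonneg] t by (metis less_imp_le)
  have nonneg: "?rhs \<ge> 0" "?rest \<ge> 0"
    using t gaussian_pos[of "t / 2" \<xi>] gaussian_pos[of "t / 4" \<xi>] L_symbol_nonneg[of \<xi>] by auto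
  have "(cmod (y' t))\<^sup>2 + ?a * (cmod (y t))\<^sup>2 \<le> ?rhs + ?rest"
  proof (cases "norm \<xi> \<le> 1")
    case True
    have "?r \<le> 1" using True by (simp add: power_le_one)
    then have a1: "?a \<le> 1" using L_symbol_le[of \<xi>] by simp
    have e: "exp (- (?a * t / 2)) \<le> gaussian (t / 2) \<xi>"
      using L_symbol_ge[OF True] t by (simp add: gaussian_def field_simps)
    have sq: "(cmod y1)\<^sup>2 \<le> M1\<^sup>2" "(cmod y0)\<^sup>2 \<le> M0\<^sup>2" using M by (auto intro!: power_mono)
    \<comment> \<open>From \<open>x \<le> exp x\<close>: the factor \<open>?r\<close> is traded for
      \<open>8 / t\<close> at the price of half the Gaussian exponent. This is the source of the
      additional \<open>1 / t\<close> in the term with \<open>u0\<close>.\<close>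
    have "?r * t / 8 \<le> exp (?r * t / 8)" using exp_ge_add_one_self[of "?r * t / 8"] by linarith
    then have "?r * t / 8 * gaussian (t / 2) \<xi> \<le> exp (?r * t / 8) * gaussian (t / 2) \<xi>"
      using gaussian_pos[of "t / 2" \<xi>] by (intro mult_right_mono) auto
    also have "\<dots> = gaussian (t / 4) \<xi>" by (simp add: gaussian_def flip: exp_add)
    finally have r: "?r * gaussian (t / 2) \<xi> \<le> 8 / t * gaussian (t / 4) \<xi>" using t by (simp add: field_simps)
    have "exp (- (?a * t / 2)) * ?a \<le> gaussian (t / 2) \<xi> * ?r"
      using e L_symbol_le[of \<xi>] L_symbol_nonneg[of \<xi>] by (intro mult_mono) (auto simp: gaussian_pos less_imp_le)
    also have "\<dots> \<le> 8 / t * gaussian (t / 4) \<xi>" using r by (simp add: mult.commute)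
    finally have ea: "exp (- (?a * t / 2)) * ?a \<le> 8 / t * gaussian (t / 4) \<xi>" .
    have "exp (- (?a * t / 2)) * (cmod y1)\<^sup>2 \<le> gaussian (t / 2) \<xi> * M1\<^sup>2"
      using e sq by (intro mult_mono) (auto simp: gaussian_pos less_imp_le)
    moreover have "exp (- (?a * t / 2)) * ?a * (cmod y0)\<^sup>2 \<le> 8 / t * gaussian (t / 4) \<xi> * M0\<^sup>2"
      using t by (intro mult_mono[OF ea sq(2)]) (auto simp: gaussian_pos less_imp_le)
    moreover have "4 * exp (- (?a * t / 2)) * ((cmod y1)\<^sup>2 + ?a * (cmod y0)\<^sup>2)
        = 4 * (exp (- (?a * t / 2)) * (cmod y1)\<^sup>2) + 4 * (exp (- (?a * t / 2)) * ?a * (cmod y0)\<^sup>2)"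
      by (simp add: algebra_simps)
    moreover have "?rhs = 4 * (gaussian (t / 2) \<xi> * M1\<^sup>2) + 4 * (8 / t * gaussian (t / 4) \<xi> * M0\<^sup>2)"
      by simp
    ultimately have "4 * exp (- (?a * t / 2)) * ((cmod y1)\<^sup>2 + ?a * (cmod y0)\<^sup>2) \<le> ?rhs"
      by linarith
    then show ?thesis using low[OF a1] nonneg by linarith
  next
    case False
    then show ?thesis using high[OF L_symbol_ge_high] nonneg by simp
  qed
  then show ?thesis using y'[of t] t by auto
qed

section \<open>Decay of solutions\<close>

lemma has_vector_derivative_within_iff_difference_quotient:
  fixes f :: "real \<Rightarrow> complex"
  shows "(f has_vector_derivative D) (at t within S) \<longleftrightarrow>
    ((\<lambda>s. (f s - f t) / complex_of_real (s - t)) \<longlongrightarrow> D) (at t within S)"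
  unfolding has_vector_derivative_complex_iff has_field_derivative_iff tendsto_complex_iff
  by (simp add: Re_divide_of_real Im_divide_of_real)

text \<open>Along a sequence of times, Plancherel carries the difference quotients to frequency
  space, and a subsequence converges almost everywhere to the transform of \<open>v\<close>. A
  pointwise derivative, where it exists, is the limit of the same quotients. Restricting to a
  sequence means that only countably many exceptional null sets occur.\<close>

lemma fourier_has_L2_derivative:
  fixes u :: "real \<Rightarrow> 'a::euclidean_space \<Rightarrow> complex"
  assumes v: "has_L2_derivative u v t" and u: "\<And>s. s \<ge> 0 \<Longrightarrow> u s \<in> L2_space" and t: "t \<ge> 0"
    and U: "\<And>s. s \<ge> 0 \<Longrightarrow> AE \<xi> in lborel. U s \<xi> = fourier (u s) \<xi>"
  shows "AE \<xi> in lborel. \<forall>D. ((\<lambda>s. U s \<xi>) has_vector_derivative D) (at t within {0..}) \<longrightarrow> D = fourier v \<xi>"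
proof -
  \<comment> \<open>Approaching from the right keeps the times in \<open>{0..}\<close>, also for
    \<open>t = 0\<close>.\<close>
  define s where "s n = t + inverse (real (Suc n))" for n
  have s: "s n \<ge> 0" "s n \<noteq> t" for n using t by (auto simp: s_def)
  have "s \<longlonglongrightarrow> t + 0"
    unfolding s_def[abs_def] by (intro tendsto_intros LIMSEQ_inverse_real_of_nat)
  then have s_lim: "filterlim s (at t within {0..}) sequentially"
    using s by (auto simp: filterlim_at intro!: always_eventually)
  have v2: "v \<in> L2_space"
    and lim: "((\<lambda>s. L2_norm (\<lambda>x. (u s x - u t x) / complex_of_real (s - t) - v x)) \<longlongrightarrow> 0) (at t within {0..})"
    using v by (auto simp: has_L2_derivative_def)
  define Q where "Q n \<xi> = inverse (complex_of_real (s n - t)) * (fourier (u (s n)) \<xi> - fourier (u t) \<xi>)" for n \<xi>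
  have Q: "is_fourier (\<lambda>x. inverse (complex_of_real (s n - t)) * (u (s n) x - u t x)) (Q n)" for n
    unfolding Q_def[abs_def]
    using s t by (intro is_fourier_cmult is_fourier_diff is_fourier_fourier u)
  have "(\<lambda>n. L2_norm (\<lambda>x. inverse (complex_of_real (s n - t)) * (u (s n) x - u t x) - v x)) \<longlonglongrightarrow> 0"
    using filterlim_compose[OF lim s_lim] by (simp add: divide_inverse mult.commute)
  then have "(\<lambda>n. sqrt (plancherel_const TYPE('a)) *
      L2_norm (\<lambda>x. inverse (complex_of_real (s n - t)) * (u (s n) x - u t x) - v x)) \<longlonglongrightarrow> 0"
    by (rule tendsto_mult_right_zero)
  then have "(\<lambda>n. L2_norm (\<lambda>\<xi>. Q n \<xi> - fourier v \<xi>)) \<longlonglongrightarrow> 0"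
    by (simp only: Plancherel[OF is_fourier_diff[OF Q is_fourier_fourier[OF v2]]])
  from L2_tendsto_AE_subseq[OF is_fourierD(2)[OF Q] L2_space_fourier[OF v2] this]
  obtain r :: "nat \<Rightarrow> nat" where r: "strict_mono r" "AE \<xi> in lborel. (\<lambda>n. Q (r n) \<xi>) \<longlonglongrightarrow> fourier v \<xi>"
    by blast
  have "AE \<xi> in lborel. \<forall>n. U (s n) \<xi> = fourier (u (s n)) \<xi>"
    unfolding AE_all_countable using U s by blast
  with U[OF t] r(2) show ?thesis
  proof eventually_elim
    case (elim \<xi>)
    show ?case
    proof (intro allI impI)
      fix D assume "((\<lambda>s. U s \<xi>) has_vector_derivative D) (at t within {0..})"
      then have "((\<lambda>s. (U s \<xi> - U t \<xi>) / complex_of_real (s - t)) \<longlongrightarrow> D) (at t within {0..})"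
        by (simp only: has_vector_derivative_within_iff_difference_quotient)
      from filterlim_compose[OF this s_lim]
      have "(\<lambda>n. Q n \<xi>) \<longlonglongrightarrow> D"
        using elim by (simp add: Q_def divide_inverse mult.commute)
      from LIMSEQ_subseq_LIMSEQ[OF this r(1)] have "(\<lambda>n. Q (r n) \<xi>) \<longlonglongrightarrow> D"
        by (simp add: o_def)
      then show "D = fourier v \<xi>" using elim(2) by (rule LIMSEQ_unique)
    qed
  qed
qed

section \<open>The energy in frequency space and the estimate for solutions\<close>

lemma L2_space_symbol_fourier:
  assumes "f \<in> sqrtL_domain"
  shows "(\<lambda>\<xi>. complex_of_real (sqrt (L_symbol \<xi>)) * fourier f \<xi>) \<in> L2_space"
proof (rule L2_spaceI)
  have f: "f \<in> L2_space" using assms by (simp add: sqrtL_domain_def)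
  show "(\<lambda>\<xi>. complex_of_real (sqrt (L_symbol \<xi>)) * fourier f \<xi>) \<in> borel_measurable borel"
    using L2_space_measurable[OF L2_space_fourier[OF f]] by measurable
  show "integrable lborel (\<lambda>\<xi>. L_symbol \<xi> * (cmod (fourier f \<xi>))\<^sup>2)"
    using assms by (simp add: sqrtL_domain_def)
qed (simp add: norm_mult power_mult_distrib L_symbol_nonneg)

text \<open>By surjectivity \<open>sqrtL f\<close> is a genuine preimage of the weighted transform,
  so Plancherel evaluates its norm.\<close>

lemma L2_norm_sqrtL:
  fixes f :: "'a::euclidean_space \<Rightarrow> complex"
  assumes "f \<in> sqrtL_domain"
  shows "plancherel_const TYPE('a) * (L2_norm (sqrtL f))\<^sup>2 = (\<integral>\<xi>. L_symbol \<xi> * (cmod (fourier f \<xi>))\<^sup>2 \<partial>lborel)"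
  using Plancherel_power2[OF is_fourier_inv_fourier[OF L2_space_symbol_fourier[OF assms]]]
  by (simp add: sqrtL_def L2_norm_power2 norm_mult power_mult_distrib L_symbol_nonneg)

lemma energy_fourier:
  fixes v w :: "'a::euclidean_space \<Rightarrow> complex"
  assumes v: "v \<in> L2_space" and w: "w \<in> sqrtL_domain"
  shows "integrable lborel (\<lambda>\<xi>. (cmod (fourier v \<xi>))\<^sup>2 + L_symbol \<xi> * (cmod (fourier w \<xi>))\<^sup>2)"
    and "(\<integral>\<xi>. (cmod (fourier v \<xi>))\<^sup>2 + L_symbol \<xi> * (cmod (fourier w \<xi>))\<^sup>2 \<partial>lborel)
      = plancherel_const TYPE('a) * ((L2_norm v)\<^sup>2 + (L2_norm (sqrtL w))\<^sup>2)"
proof -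
  have i: "integrable lborel (\<lambda>\<xi>. (cmod (fourier v \<xi>))\<^sup>2)"
    "integrable lborel (\<lambda>\<xi>. L_symbol \<xi> * (cmod (fourier w \<xi>))\<^sup>2)"
    using w by (auto simp: sqrtL_domain_def intro: L2_spaceD L2_space_fourier v)
  then show "integrable lborel (\<lambda>\<xi>. (cmod (fourier v \<xi>))\<^sup>2 + L_symbol \<xi> * (cmod (fourier w \<xi>))\<^sup>2)"
    by (rule Bochner_Integration.integrable_add)
  show "(\<integral>\<xi>. (cmod (fourier v \<xi>))\<^sup>2 + L_symbol \<xi> * (cmod (fourier w \<xi>))\<^sup>2 \<partial>lborel)
      = plancherel_const TYPE('a) * ((L2_norm v)\<^sup>2 + (L2_norm (sqrtL w))\<^sup>2)"
    using i Plancherel_power2[OF is_fourier_fourier[OF v]] L2_norm_sqrtL[OF w]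
    by (simp add: L2_norm_power2 distrib_left)
qed

text \<open>The Gaussian terms use the integrable data \<open>u0\<close> and \<open>u1\<close>, the
  last term the curve at time 0, because the energy is defined from the curve.\<close>

lemma solution_pointwise_decay:
  fixes u :: "real \<Rightarrow> 'a::euclidean_space \<Rightarrow> complex"
  assumes u0: "u0 \<in> L2_space \<inter> L1_space" and u1: "u1 \<in> L2_space \<inter> L1_space"
    and sol: "is_solution u0 u1 u" and t: "t > 0"
  shows "AE \<xi> in lborel. (cmod (fourier (time_deriv u t) \<xi>))\<^sup>2 + L_symbol \<xi> * (cmod (fourier (u t) \<xi>))\<^sup>2
      \<le> 4 * (L1_norm u1)\<^sup>2 * gaussian (t / 2) \<xi> + 32 / t * (L1_norm u0)\<^sup>2 * gaussian (t / 4) \<xi>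
        + 3 * exp (- (3 * t / 10)) *
          ((cmod (fourier (time_deriv u 0) \<xi>))\<^sup>2 + L_symbol \<xi> * (cmod (fourier (u 0) \<xi>))\<^sup>2)"
proof -
  obtain U where U: "\<And>s. s \<ge> 0 \<Longrightarrow> AE \<xi> in lborel. U s \<xi> = fourier (u s) \<xi>"
    and ode: "AE \<xi> in lborel. solves_ode (L_symbol \<xi>) (fourier u0 \<xi>) (fourier u1 \<xi>) (\<lambda>t. U t \<xi>)"
    using sol unfolding is_solution_def by blast
  have u: "u s \<in> L2_space" and du: "has_L2_derivative u (time_deriv u s) s" if "s \<ge> 0" for s
    using sol that unfolding is_solution_def C1_L2_curve_def by blast+
  have D: "AE \<xi> in lborel. \<forall>D. ((\<lambda>s. U s \<xi>) has_vector_derivative D) (at s within {0..})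
      \<longrightarrow> D = fourier (time_deriv u s) \<xi>" if "s \<ge> 0" for s
    by (rule fourier_has_L2_derivative[OF du u _ U]) (use that in auto)
  have t0: "t \<ge> 0" using t by simp
  have M: "AE \<xi> in lborel. cmod (fourier u0 \<xi>) \<le> L1_norm u0" "AE \<xi> in lborel. cmod (fourier u1 \<xi>) \<le> L1_norm u1"
    using u0 u1 by (auto intro: AE_cmod_fourier_le)
  show ?thesis
    using ode U[OF t0] U[OF order_refl] D[OF t0] D[OF order_refl] M
  proof eventually_elim
    case (elim \<xi>)
    obtain y' where "\<forall>s\<ge>0. ((\<lambda>s. U s \<xi>) has_vector_derivative y' s) (at s within {0..})"
      "U 0 \<xi> = fourier u0 \<xi>" "y' 0 = fourier u1 \<xi>"
      using elim(1) unfolding solves_ode_def by blast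
    \<comment> \<open>The initial value of \<open>U\<close> identifies \<open>u 0\<close> with
      \<open>u0\<close>; the derivative identification at time 0 does the same for
      \<open>time_deriv u 0\<close> and \<open>u1\<close>.\<close>
    then have init: "fourier (u 0) \<xi> = fourier u0 \<xi>" "fourier (time_deriv u 0) \<xi> = fourier u1 \<xi>"
      using elim by auto
    show ?case
      using solves_ode_pointwise_decay[OF elim(1) t elim(6,7)] elim(2,4) init by auto
  qed
qed

text \<open>Integration of the pointwise bound over all frequencies. The radicands are
  \<open>2 * pi / \<epsilon>\<close> for the two Gaussian parameters \<open>t / 2\<close> and
  \<open>t / 4\<close>.\<close>

lemma solution_decay:
  fixes u :: "real \<Rightarrow> 'a::euclidean_space \<Rightarrow> complex"
  assumes u0: "u0 \<in> sqrtL_domain \<inter> L1_space" and u1: "u1 \<in> L2_space \<inter> L1_space"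
    and sol: "is_solution u0 u1 u" and t: "t > 0"
  shows "plancherel_const TYPE('a) * ((L2_norm (time_deriv u t))\<^sup>2 + (L2_norm (sqrtL (u t)))\<^sup>2)
    \<le> 4 * (L1_norm u1)\<^sup>2 * sqrt (4 * pi / t) ^ DIM('a) + 32 / t * (L1_norm u0)\<^sup>2 * sqrt (8 * pi / t) ^ DIM('a)
      + 3 * exp (- (3 * t / 10)) * (plancherel_const TYPE('a) * (2 * energy u 0))"
proof -
  have u: "u s \<in> sqrtL_domain" and du: "time_deriv u s \<in> L2_space" if "s \<ge> 0" for s
    using sol that unfolding is_solution_def C1_L2_curve_def has_L2_derivative_def by blast+
  let ?E = "\<lambda>s \<xi>. (cmod (fourier (time_deriv u s) \<xi>))\<^sup>2 + L_symbol \<xi> * (cmod (fourier (u s) \<xi>))\<^sup>2"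
  have E: "integrable lborel (?E s)"
    "(\<integral>\<xi>. ?E s \<xi> \<partial>lborel) = plancherel_const TYPE('a) * ((L2_norm (time_deriv u s))\<^sup>2 + (L2_norm (sqrtL (u s)))\<^sup>2)"
    if "s \<ge> 0" for s
    using energy_fourier[OF du u] that by auto
  have g: "integrable lborel (gaussian (t / 2) :: 'a \<Rightarrow> real)" "integrable lborel (gaussian (t / 4) :: 'a \<Rightarrow> real)"
    using t by (auto intro: integrable_gaussian)
  note i = Bochner_Integration.integrable_mult_right[OF g(1), of "4 * (L1_norm u1)\<^sup>2"]
    Bochner_Integration.integrable_mult_right[OF g(2), of "32 / t * (L1_norm u0)\<^sup>2"]
    Bochner_Integration.integrable_mult_right[OF E(1)[OF order_refl], of "3 * exp (- (3 * t / 10))"]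
  have "(\<integral>\<xi>. ?E t \<xi> \<partial>lborel) \<le> (\<integral>\<xi>. 4 * (L1_norm u1)\<^sup>2 * gaussian (t / 2) \<xi>
      + 32 / t * (L1_norm u0)\<^sup>2 * gaussian (t / 4) \<xi> + 3 * exp (- (3 * t / 10)) * ?E 0 \<xi> \<partial>lborel)"
    using u0 t
    by (intro integral_mono_AE solution_pointwise_decay[OF _ u1 sol t] Bochner_Integration.integrable_add i E) (auto simp: sqrtL_domain_def)
  also have "\<dots> = (\<integral>\<xi>. 4 * (L1_norm u1)\<^sup>2 * gaussian (t / 2) (\<xi>::'a) \<partial>lborel)
      + (\<integral>\<xi>. 32 / t * (L1_norm u0)\<^sup>2 * gaussian (t / 4) (\<xi>::'a) \<partial>lborel)
      + (\<integral>\<xi>. 3 * exp (- (3 * t / 10)) * ?E 0 \<xi> \<partial>lborel)"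
    by (simp only: Bochner_Integration.integral_add[OF Bochner_Integration.integrable_add[OF i(1,2)] i(3)]
          Bochner_Integration.integral_add[OF i(1,2)])
  also have "\<dots> = 4 * (L1_norm u1)\<^sup>2 * sqrt (4 * pi / t) ^ DIM('a) + 32 / t * (L1_norm u0)\<^sup>2 * sqrt (8 * pi / t) ^ DIM('a)
      + 3 * exp (- (3 * t / 10)) * (plancherel_const TYPE('a) * (2 * energy u 0))"
    using t E(2)[of 0] by (simp only: integral_mult_right_zero) (simp add: integral_gaussian energy_def)
  finally show ?thesis using E(2)[of t] t by simp
qed

theorem proposition1p1:
  "\<exists>C>0. \<forall>(u0 :: real ^ 'n \<Rightarrow> complex) (u1 :: real ^ 'n \<Rightarrow> complex) (u :: real \<Rightarrow> real ^ 'n \<Rightarrow> complex).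
     u0 \<in> sqrtL_domain \<inter> L1_space \<longrightarrow> u1 \<in> L2_space \<inter> L1_space \<longrightarrow> is_solution u0 u1 u \<longrightarrow>
     (\<forall>\<^sub>F t in at_top.
        (L2_norm (time_deriv u t))\<^sup>2 + (L2_norm (sqrtL (u t)))\<^sup>2
          \<le> C * ((L1_norm u1)\<^sup>2 * t powr (- real CARD('n) / 2)
                 + (L1_norm u0)\<^sup>2 * t powr (- (real CARD('n) + 2) / 2))
            + 2 powr (- t / 4) * ((L2_norm u1)\<^sup>2 + (L2_norm u0)\<^sup>2)
            + 2 * exp (- t / 4) * energy u 0)"
proof -
  define c where "c = plancherel_const TYPE(real ^ 'n)"
  \<comment> \<open>Both constants of the \<open>u0\<close> term, 32 and \<open>8 * pi\<close>,
    dominate those of the \<open>u1\<close> term, 4 and \<open>4 * pi\<close>; the division by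
    \<open>c\<close> undoes Plancherel.\<close>
  define C where "C = 32 * sqrt (8 * pi) ^ CARD('n) / c"
  have c: "c > 0" unfolding c_def by (rule plancherel_const_pos)
  have C: "C > 0" unfolding C_def using c by simp
  have "(L2_norm (time_deriv u t))\<^sup>2 + (L2_norm (sqrtL (u t)))\<^sup>2
          \<le> C * ((L1_norm u1)\<^sup>2 * t powr (- real CARD('n) / 2)
                 + (L1_norm u0)\<^sup>2 * t powr (- (real CARD('n) + 2) / 2))
            + 2 powr (- t / 4) * ((L2_norm u1)\<^sup>2 + (L2_norm u0)\<^sup>2)
            + 2 * exp (- t / 4) * energy u 0"
    if u: "u0 \<in> sqrtL_domain \<inter> L1_space" "u1 \<in> L2_space \<inter> L1_space" "is_solution u0 u1 u" and t: "t \<ge> 40"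
    for u0 u1 :: "real ^ 'n \<Rightarrow> complex" and u t
  proof -
    define P where "P = t powr (- real CARD('n) / 2)"
    have P: "sqrt (k * pi / t) ^ CARD('n) = sqrt (k * pi) ^ CARD('n) * P" if "k \<ge> 0" for k
    proof -
      have "inverse (sqrt t) ^ CARD('n) = P"
        using t by (simp add: P_def powr_half_sqrt[symmetric] powr_minus[symmetric] powr_powr flip: powr_realpow)
      then show ?thesis by (simp only: real_sqrt_divide) (simp only: divide_inverse power_mult_distrib)
    qed
    have P0: "P \<ge> 0" by (simp add: P_def)
    have Pt: "t powr (- (real CARD('n) + 2) / 2) = P / t"
    proof -
      have "- (real CARD('n) + 2) / 2 = - real CARD('n) / 2 - 1" by (simp add: field_simps)
      then have "t powr (- (real CARD('n) + 2) / 2) = P / t powr 1"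
        by (simp only: P_def powr_diff)
      then show ?thesis using t by simp
    qed
    have En: "energy u 0 \<ge> 0" by (simp add: energy_def)
    \<comment> \<open>The gap between the rates \<open>3 / 10\<close> and \<open>1 / 4\<close> is
      \<open>1 / 20\<close>; at \<open>t \<ge> 40\<close> it already compensates the factor 3, since
      \<open>1 + 40 / 20 = 3\<close>.\<close>
    have "3 \<le> exp (t / 20)" using exp_ge_add_one_self[of "t / 20"] t by linarith
    then have "3 * exp (- (3 * t / 10)) \<le> exp (t / 20) * exp (- (3 * t / 10))" by (intro mult_right_mono) auto
    also have "\<dots> = exp (- t / 4)" by (simp flip: exp_add)
    finally have "3 * exp (- (3 * t / 10)) * (c * (2 * energy u 0)) \<le> exp (- t / 4) * (c * (2 * energy u 0))"
      using c En by (intro mult_right_mono) auto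
    moreover have "4 * (L1_norm u1)\<^sup>2 * (sqrt (4 * pi) ^ CARD('n) * P) \<le> 32 * (L1_norm u1)\<^sup>2 * (sqrt (8 * pi) ^ CARD('n) * P)"
      using P0 by (intro mult_mono[OF _ mult_right_mono[OF power_mono]]) auto
    moreover have "c * ((L2_norm (time_deriv u t))\<^sup>2 + (L2_norm (sqrtL (u t)))\<^sup>2)
        \<le> 4 * (L1_norm u1)\<^sup>2 * (sqrt (4 * pi) ^ CARD('n) * P) + 32 / t * (L1_norm u0)\<^sup>2 * (sqrt (8 * pi) ^ CARD('n) * P)
          + 3 * exp (- (3 * t / 10)) * (c * (2 * energy u 0))"
    proof -
      have "t > 0" "DIM(real ^ 'n) = CARD('n)" using t by auto
      then show ?thesis
        using solution_decay[OF u, of t] P[of 4] P[of 8] by (simp only: c_def)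
    qed
    ultimately have "c * ((L2_norm (time_deriv u t))\<^sup>2 + (L2_norm (sqrtL (u t)))\<^sup>2)
        \<le> 32 * (L1_norm u1)\<^sup>2 * (sqrt (8 * pi) ^ CARD('n) * P) + 32 / t * (L1_norm u0)\<^sup>2 * (sqrt (8 * pi) ^ CARD('n) * P)
          + exp (- t / 4) * (c * (2 * energy u 0))"
      by linarith
    also have "\<dots> = c * (C * ((L1_norm u1)\<^sup>2 * P + (L1_norm u0)\<^sup>2 * (P / t)) + 2 * exp (- t / 4) * energy u 0)"
      unfolding C_def using c by (simp add: field_simps)
    finally have "(L2_norm (time_deriv u t))\<^sup>2 + (L2_norm (sqrtL (u t)))\<^sup>2
        \<le> C * ((L1_norm u1)\<^sup>2 * P + (L1_norm u0)\<^sup>2 * (P / t)) + 2 * exp (- t / 4) * energy u 0"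
      using c by simp
    moreover have "0 \<le> 2 powr (- t / 4) * ((L2_norm u1)\<^sup>2 + (L2_norm u0)\<^sup>2)" by simp
    ultimately show ?thesis unfolding Pt P_def[symmetric] by linarith
  qed
  \<comment> \<open>The threshold 40 does not depend on the data or on the dimension.\<close>
  from eventually_mono[OF eventually_ge_at_top[of "40 :: real"] this] show ?thesis
    by (intro exI[of _ C] conjI C allI impI)
qed

end
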